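(* The Carleman embedding $i:H^1\to L_a^2(\mathbb{D})$ has completely bounded norm $$\|i:H^1\to L_a^2(\mathbb{D})\|_{cb}=\sqrt{\pi}.$$
   Context: $\mathbb{T}$ is the unit circle with normalized Haar measure; $H^1=\{f\in L^1(\mathbb{T}):\widehat f(n)=0\ \forall n<0\}$. $\mathbb{D}$ is the open unit disk with normalized area measure $dA=\frac{dx\,dy}{\pi}$; $L_a^2(\mathbb{D})$ is the Bergman space of holomorphic functions in $L^2(\mathbb{D},dA)$. The map $i$ sends $f=\sum_{n\ge0}\widehat f(n)e^{in\theta}$ to its holomorphic extension $\sum_{n\ge0}\widehat f(n)z^n$. Operator space structures: $L^1(\mathbb{T})$ has its structure as predual of the commutative $C^*$-algebra $L^\infty(\mathbb{T})$, and $H^1$ is viewed as a subspace of it; $L^2(\mathbb{D})$ has its natural structure, that of Pisier's operator Hilbert space $OH$ (i.e. $L^2=(L^\infty,L^1)_{1/2}$), and $L_a^2(\mathbb{D})$ is viewed as a subspace of it. $OH$ is characterized by: for orthonormal vectors $v_i$ and finitely many elements $a_i$ of a $C^*$-algebra $A$, $\|\sum_iv_i\otimes a_i\|_{OH\otimes_{\min}A}=\|\sum_ia_i\otimes\overline a_i\|^{1/2}_{A\otimes_{\min}\overline A}$, where $\overline{A}$ is the complex conjugate $C^*$-algebra. *)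

theory Defs
  imports "HOL-Complex_Analysis.Complex_Analysis" "HOL-Probability.Essential_Supremum"
begin

section \<open>Matrix norms and completely bounded norms\<close>

text \<open>
  Square matrices are functions of two indices, looked at only on a finite index set.
  \<open>matrix_op_norm I a\<close> is the norm of \<open>a\<close> as an operator on the Hilbert space \<open>l\<^sup>2(I)\<close>.
  Tensor products of matrices are indexed by pairs, so \<open>M\<^sub>m \<otimes>\<^sub>m\<^sub>i\<^sub>n M\<^sub>n\<close> carries
  the norm \<open>matrix_op_norm ({..<m} \<times> {..<n})\<close>.
\<close>

definition matrix_op_norm :: "'i set \<Rightarrow> ('i \<Rightarrow> 'i \<Rightarrow> complex) \<Rightarrow> real" where
  "matrix_op_norm I a =
     (SUP x \<in> {x. L2_set (\<lambda>j. cmod (x j)) I \<le> 1}. L2_set (\<lambda>i. cmod (\<Sum>j\<in>I. a i j * x j)) I)"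

text \<open>
  An operator space is given by a carrier set together with a matrix norm: \<open>N n x\<close> is the norm
  in \<open>M\<^sub>n(V)\<close> of the matrix \<open>(x i j)\<close>, \<open>i, j < n\<close>. Entries of \<open>x\<close> outside this range
  are irrelevant. Functions are not identified modulo null sets, so these are seminorms in general.
\<close>

type_synonym 'v matrix_norm = "nat \<Rightarrow> (nat \<Rightarrow> nat \<Rightarrow> 'v) \<Rightarrow> ennreal"

definition cb_norm :: "'v set \<Rightarrow> 'v matrix_norm \<Rightarrow> 'w matrix_norm \<Rightarrow> ('v \<Rightarrow> 'w) \<Rightarrow> ennreal" where
  "cb_norm V N M u =
     (SUP (n, x) \<in> {(n, x). (\<forall>i<n. \<forall>j<n. x i j \<in> V) \<and> N n x \<le> 1}. M n (\<lambda>i j. u (x i j)))"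

text \<open>The operator space structure of the \<open>C\<^sup>*\<close>-algebra \<open>M\<^sub>n\<close>.\<close>

definition Mn_matrix_norm :: "nat \<Rightarrow> (nat \<Rightarrow> nat \<Rightarrow> complex) matrix_norm" where
  "Mn_matrix_norm n m x =
     ennreal (matrix_op_norm ({..<m} \<times> {..<n}) (\<lambda>(k, i) (l, j). x k l i j))"


section \<open>The circle: \<open>L\<^sup>\<infinity>\<close>, \<open>L\<^sup>1\<close> and \<open>H\<^sup>1\<close>\<close>

definition circle_measure :: "complex measure" where
  "circle_measure =
     distr (density (restrict_space lborel {0..2 * pi}) (\<lambda>_. ennreal (1 / (2 * pi))))
           (restrict_space borel (sphere 0 1)) cis"

definition circle_Linf :: "(complex \<Rightarrow> complex) set" where
  "circle_Linf = {g \<in> borel_measurable circle_measure.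
                    esssup circle_measure (\<lambda>\<zeta>. ennreal (cmod (g \<zeta>))) < \<infinity>}"

text \<open>The structure of the commutative \<open>C\<^sup>*\<close>-algebra \<open>L\<^sup>\<infinity>\<close>, via \<open>M\<^sub>n(L\<^sup>\<infinity>) = L\<^sup>\<infinity>(M\<^sub>n)\<close>.\<close>

definition Linf_matrix_norm :: "(complex \<Rightarrow> complex) matrix_norm" where
  "Linf_matrix_norm n g =
     esssup circle_measure (\<lambda>\<zeta>. ennreal (matrix_op_norm {..<n} (\<lambda>k l. g k l \<zeta>)))"

text \<open>
  The structure of \<open>L\<^sup>1\<close> as the predual of \<open>L\<^sup>\<infinity>\<close>: it is inherited from the operator space dual of
  \<open>L\<^sup>\<infinity>\<close>, where \<open>M\<^sub>n(V\<^sup>*) = CB(V, M\<^sub>n)\<close>.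
\<close>

definition L1_matrix_norm :: "(complex \<Rightarrow> complex) matrix_norm" where
  "L1_matrix_norm n f =
     cb_norm circle_Linf Linf_matrix_norm (Mn_matrix_norm n)
       (\<lambda>g i j. LINT \<zeta>|circle_measure. f i j \<zeta> * g \<zeta>)"

definition fourier_coeff :: "(complex \<Rightarrow> complex) \<Rightarrow> int \<Rightarrow> complex" where
  "fourier_coeff f n = (LINT \<zeta>|circle_measure. f \<zeta> * \<zeta> powi (- n))"

definition Hardy1 :: "(complex \<Rightarrow> complex) set" where
  "Hardy1 = {f. integrable circle_measure f \<and> (\<forall>n<0. fourier_coeff f n = 0)}"


section \<open>Operator Hilbert space and the Bergman space\<close>

definition square_integrable :: "'a measure \<Rightarrow> ('a \<Rightarrow> complex) set" where
  "square_integrable M = {h \<in> borel_measurable M. integrable M (\<lambda>z. (cmod (h z))\<^sup>2)}"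

definition orthonormal_family :: "'a measure \<Rightarrow> nat \<Rightarrow> (nat \<Rightarrow> 'a \<Rightarrow> complex) \<Rightarrow> bool" where
  "orthonormal_family M d v \<longleftrightarrow>
     (\<forall>k<d. v k \<in> square_integrable M) \<and>
     (\<forall>k<d. \<forall>l<d. (LINT z|M. v k z * cnj (v l z)) = (if k = l then 1 else 0))"

text \<open>
  The \<open>OH\<close> structure of \<open>L\<^sup>2(M)\<close>: if \<open>h = \<Sum>\<^sub>k v\<^sub>k \<otimes> a\<^sub>k\<close> with \<open>v\<close> orthonormal and \<open>a\<^sub>k \<in> M\<^sub>n\<close>,
  then its norm is the square root of the norm of \<open>\<Sum>\<^sub>k a\<^sub>k \<otimes> cnj a\<^sub>k\<close>, where the conjugate
  \<open>C\<^sup>*\<close>-algebra of \<open>M\<^sub>n\<close> is identified with \<open>M\<^sub>n\<close> by entrywise conjugation. All expansions of \<open>h\<close>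
  give the same value (see \<open>OH_matrix_norm_expansion\<close> below), so the infimum merely selects it;
  it is \<open>\<infinity>\<close> if some entry of \<open>h\<close> is not in \<open>L\<^sup>2(M)\<close>.
\<close>

definition conj_tensor_norm :: "nat \<Rightarrow> nat \<Rightarrow> (nat \<Rightarrow> nat \<Rightarrow> nat \<Rightarrow> complex) \<Rightarrow> real" where
  "conj_tensor_norm n d a =
     matrix_op_norm ({..<n} \<times> {..<n}) (\<lambda>(i, p) (j, q). \<Sum>k<d. a k i j * cnj (a k p q))"

definition orthonormal_expansion ::
  "'a measure \<Rightarrow> nat \<Rightarrow> (nat \<Rightarrow> nat \<Rightarrow> 'a \<Rightarrow> complex) \<Rightarrow>
   nat \<Rightarrow> (nat \<Rightarrow> 'a \<Rightarrow> complex) \<Rightarrow> (nat \<Rightarrow> nat \<Rightarrow> nat \<Rightarrow> complex) \<Rightarrow> bool" where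
  "orthonormal_expansion M n h d v a \<longleftrightarrow>
     orthonormal_family M d v \<and>
     (\<forall>i<n. \<forall>j<n. h i j \<in> borel_measurable M \<and>
                    (AE z in M. h i j z = (\<Sum>k<d. a k i j * v k z)))"

definition OH_matrix_norm :: "'a measure \<Rightarrow> ('a \<Rightarrow> complex) matrix_norm" where
  "OH_matrix_norm M n h =
     (INF (d, v, a) \<in> {(d, v, a). orthonormal_expansion M n h d v a}.
        ennreal (sqrt (conj_tensor_norm n d a)))"

lemma square_integrable_mult_cnj:
  assumes "f \<in> square_integrable M" "g \<in> square_integrable M"
  shows "integrable M (\<lambda>z. f z * cnj (g z))"
proof (rule Bochner_Integration.integrable_bound)
  show "integrable M (\<lambda>z. (cmod (f z))\<^sup>2 + (cmod (g z))\<^sup>2)"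
    using assms by (auto simp: square_integrable_def)
  have [measurable]: "f \<in> borel_measurable M" "g \<in> borel_measurable M"
    using assms by (auto simp: square_integrable_def)
  have "cnj \<in> borel_measurable borel"
    by (intro borel_measurable_continuous_onI continuous_intros)
  then have [measurable]: "(\<lambda>z. cnj (g z)) \<in> borel_measurable M"
    by (rule measurable_compose[rotated]) simp
  show "(\<lambda>z. f z * cnj (g z)) \<in> borel_measurable M"
    by measurable
  have "cmod (f z) * cmod (g z) \<le> (cmod (f z))\<^sup>2 + (cmod (g z))\<^sup>2" for z
  proof -
    have "2 * (cmod (f z) * cmod (g z)) \<le> (cmod (f z))\<^sup>2 + (cmod (g z))\<^sup>2"
      using sum_squares_bound[of "cmod (f z)" "cmod (g z)"] by (simp add: mult.assoc)
    moreover have "0 \<le> cmod (f z) * cmod (g z)" by simp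
    ultimately show ?thesis by linarith
  qed
  then show "AE z in M. norm (f z * cnj (g z)) \<le> norm ((cmod (f z))\<^sup>2 + (cmod (g z))\<^sup>2)"
    by (simp add: norm_mult)
qed

lemma orthonormal_expansion_gram:
  assumes "orthonormal_expansion M n h d v a" "i < n" "j < n" "p < n" "q < n"
  shows "(LINT z|M. h i j z * cnj (h p q z)) = (\<Sum>k<d. a k i j * cnj (a k p q))"
proof -
  have v: "k < d \<Longrightarrow> v k \<in> square_integrable M"
    and on: "k < d \<Longrightarrow> l < d \<Longrightarrow> (LINT z|M. v k z * cnj (v l z)) = (if k = l then 1 else 0)" for k l
    using assms(1) by (auto simp: orthonormal_expansion_def orthonormal_family_def)
  have m [measurable]: "h i j \<in> borel_measurable M" "h p q \<in> borel_measurable M"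
    using assms by (auto simp: orthonormal_expansion_def)
  have int: "k < d \<Longrightarrow> l < d \<Longrightarrow> integrable M (\<lambda>z. v k z * cnj (v l z))" for k l
    using v by (intro square_integrable_mult_cnj)
  have cm: "cnj \<in> borel_measurable borel"
    by (intro borel_measurable_continuous_onI continuous_intros)
  have vm: "k < d \<Longrightarrow> v k \<in> borel_measurable M" for k
    using v by (auto simp: square_integrable_def)
  have vc: "k < d \<Longrightarrow> (\<lambda>z. cnj (v k z)) \<in> borel_measurable M" for k
    by (rule measurable_compose[OF vm cm])
  have [measurable]: "(\<lambda>z. cnj (h p q z)) \<in> borel_measurable M"
    by (rule measurable_compose[OF m(2) cm])
  have "AE z in M. h i j z = (\<Sum>k<d. a k i j * v k z)" "AE z in M. h p q z = (\<Sum>k<d. a k p q * v k z)"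
    using assms by (auto simp: orthonormal_expansion_def)
  then have ae: "AE z in M. h i j z * cnj (h p q z) =
      (\<Sum>k<d. \<Sum>l<d. a k i j * cnj (a l p q) * (v k z * cnj (v l z)))"
    by eventually_elim (simp add: sum_product algebra_simps)
  have "(LINT z|M. h i j z * cnj (h p q z)) =
      (LINT z|M. (\<Sum>k<d. \<Sum>l<d. a k i j * cnj (a l p q) * (v k z * cnj (v l z))))"
  proof (rule integral_cong_AE)
    show "(\<lambda>z. \<Sum>k<d. \<Sum>l<d. a k i j * cnj (a l p q) * (v k z * cnj (v l z))) \<in> borel_measurable M"
      by (intro borel_measurable_sum borel_measurable_times borel_measurable_const
          vm vc) auto
  qed (use ae in simp_all)
  also have "\<dots> = (\<Sum>k<d. \<Sum>l<d. a k i j * cnj (a l p q) * (LINT z|M. v k z * cnj (v l z)))"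
  proof -
    have int': "k < d \<Longrightarrow> l < d \<Longrightarrow>
        integrable M (\<lambda>z. a k i j * cnj (a l p q) * (v k z * cnj (v l z)))" for k l
      using int by (intro integrable_mult_right)
    have "(LINT z|M. (\<Sum>k<d. \<Sum>l<d. a k i j * cnj (a l p q) * (v k z * cnj (v l z)))) =
        (\<Sum>k<d. LINT z|M. (\<Sum>l<d. a k i j * cnj (a l p q) * (v k z * cnj (v l z))))"
      by (rule Bochner_Integration.integral_sum, rule Bochner_Integration.integrable_sum, rule int') auto
    also have "\<dots> = (\<Sum>k<d. \<Sum>l<d. LINT z|M. a k i j * cnj (a l p q) * (v k z * cnj (v l z)))"
      by (rule sum.cong[OF refl], rule Bochner_Integration.integral_sum, rule int') auto
    also have "\<dots> = (\<Sum>k<d. \<Sum>l<d. a k i j * cnj (a l p q) * (LINT z|M. v k z * cnj (v l z)))"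
      by simp
    finally show ?thesis .
  qed
  also have "\<dots> = (\<Sum>k<d. \<Sum>l<d. if l = k then a k i j * cnj (a k p q) else 0)"
    using on by (intro sum.cong refl) auto
  also have "\<dots> = (\<Sum>k<d. a k i j * cnj (a k p q))"
    by simp
  finally show ?thesis .
qed

lemma matrix_op_norm_cong:
  assumes "\<And>i j. i \<in> I \<Longrightarrow> j \<in> I \<Longrightarrow> a i j = b i j"
  shows "matrix_op_norm I a = matrix_op_norm I b"
  unfolding matrix_op_norm_def
  by (intro SUP_cong refl L2_set_cong arg_cong[where f = cmod] sum.cong) (use assms in auto)

theorem OH_matrix_norm_expansion:
  assumes "orthonormal_expansion M n h d v a"
  shows "OH_matrix_norm M n h = ennreal (sqrt (conj_tensor_norm n d a))"
proof -
  have "conj_tensor_norm n d' a' = conj_tensor_norm n d a"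
    if "orthonormal_expansion M n h d' v' a'" for d' v' a'
    unfolding conj_tensor_norm_def
    by (rule matrix_op_norm_cong)
       (use orthonormal_expansion_gram[OF that] orthonormal_expansion_gram[OF assms] in auto)
  then have eq: "(\<lambda>(d, v, a). ennreal (sqrt (conj_tensor_norm n d a))) x =
      ennreal (sqrt (conj_tensor_norm n d a))"
    if "x \<in> {(d, v, a). orthonormal_expansion M n h d v a}" for x
    using that by (cases x) auto
  show ?thesis
    unfolding OH_matrix_norm_def
  proof (rule INF_eq_const)
    show "{(d, v, a). orthonormal_expansion M n h d v a} \<noteq> {}"
      using assms by blast
  qed (rule eq)
qed

definition disk_measure :: "complex measure" where
  "disk_measure = density (restrict_space lborel (ball 0 1)) (\<lambda>_. ennreal (1 / pi))"

definition Bergman2 :: "(complex \<Rightarrow> complex) set" where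
  "Bergman2 = {h. h holomorphic_on ball 0 1} \<inter> square_integrable disk_measure"

definition carleman :: "(complex \<Rightarrow> complex) \<Rightarrow> complex \<Rightarrow> complex" where
  "carleman f z = (\<Sum>n. fourier_coeff f (int n) * z ^ n)"

end

theory Submission
  imports Defs "HOL-Probability.Distribution_Functions"
begin

text \<open>
  Write \<open>F = \<Sum> a\<^sub>n z\<^sup>n\<close> and \<open>G = \<Sum> b\<^sub>n z\<^sup>n\<close> for the images of \<open>f, g \<in> H\<^sup>1\<close>. Monomials are orthogonal in the
  Bergman space and \<open>z\<^sup>n\<close> has squared norm \<open>1 / (n + 1)\<close>, so \<open>\<langle>F, G\<rangle> = \<Sum> a\<^sub>n cnj b\<^sub>n / (n + 1)\<close>. The weights
  \<open>1 / (n + 1)\<close> are the entries of the Hilbert matrix, whose norm \<open>\<pi>\<close> is the square of the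
  completely bounded norm. The \<open>OH\<close> norm enters only through \<open>OH_matrix_norm_eq_gram\<close>: the squared
  norm of a matrix over \<open>L\<^sup>2\<close> is the operator norm of its Gram matrix, an element of \<open>M\<^sub>n \<otimes> M\<^sub>n\<close>.

  Upper bound. The numbers \<open>1 / (n + 1)\<close>, \<open>n \<ge> 0\<close>, are Fourier coefficients of a function \<open>\<psi>\<close> on the circle
  with supremum norm \<open>\<pi>\<close> (a modulated sawtooth), and the negative coefficients of \<open>\<psi>\<close> are invisible to \<open>H\<^sup>1\<close>.
  Hence \<open>\<langle>F, G\<rangle> = \<integral>\<integral> f(s) cnj (g(t)) \<psi>(t / s) dt ds\<close>. For a matrix \<open>f\<close> over \<open>H\<^sup>1\<close> of norm at most \<open>1\<close> in
  \<open>M\<^sub>n(L\<^sup>1) \<subseteq> CB(L\<^sup>\<infinity>, M\<^sub>n)\<close>, the inner integral is for each \<open>s\<close> the image of a scalar function bounded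
  by \<open>\<pi>\<close>, hence an \<open>n \<times> n\<close> matrix of norm at most \<open>\<pi>\<close>; as a function of \<open>s\<close> it lies in \<open>M\<^sub>n(L\<^sup>\<infinity>)\<close>, so the
  outer integral has norm at most \<open>\<pi>\<close> in \<open>M\<^sub>n \<otimes> M\<^sub>n\<close>. All of this is done on the disk of radius \<open>r < 1\<close>, which
  replaces the sawtooth by its Poisson mean of radius \<open>r\<^sup>2\<close> (\<open>hilbert_kernel\<close>, \<open>carleman_gram_eq_hilbert\<close>); then
  every series converges absolutely, and \<open>r \<rightarrow> 1\<close> by monotone and dominated convergence. The scalar case
  also shows that \<open>F\<close> is square integrable.

  Lower bound. The Hankel matrix \<open>f\<^sub>i\<^sub>j = \<zeta>\<^sup>i\<^sup>+\<^sup>j\<close>, \<open>i, j < n\<close>, has norm at most \<open>1\<close> in \<open>M\<^sub>n(L\<^sup>1)\<close>, because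
  pairing it with \<open>g\<close> compresses, up to a reversal of the basis, the multiplication operator of \<open>g\<close> (\<open>L1_matrix_norm_hankel\<close>). Restricted
  to the span of the vectors \<open>e\<^sub>j \<otimes> e\<^sub>j\<close>, its Gram matrix is the \<open>n \<times> n\<close> Hilbert matrix
  (\<open>hankel_gram_norm_ge\<close>), and the norm of the latter tends to \<open>\<pi>\<close> (\<open>hilbert_form_near_pi\<close>).
\<close>


section \<open>Matrices as bilinear forms\<close>

text \<open>
  There is no conjugation in \<open>y\<close>: the vectors range over balls invariant under conjugation, and
  the bilinear form is what the integrals below produce.
\<close>

definition bform :: "'i set \<Rightarrow> ('i \<Rightarrow> 'i \<Rightarrow> complex) \<Rightarrow> ('i \<Rightarrow> complex) \<Rightarrow> ('i \<Rightarrow> complex) \<Rightarrow> complex" where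
  "bform I a y x = (\<Sum>i\<in>I. y i * (\<Sum>j\<in>I. a i j * x j))"

lemma cmod_sum_mult_le_L2:
  "cmod (\<Sum>i\<in>I. y i * z i) \<le> L2_set (\<lambda>i. cmod (y i)) I * L2_set (\<lambda>i. cmod (z i)) I"
proof -
  have "cmod (\<Sum>i\<in>I. y i * z i) \<le> (\<Sum>i\<in>I. \<bar>cmod (y i)\<bar> * \<bar>cmod (z i)\<bar>)"
    by (rule order_trans[OF norm_sum]) (simp add: norm_mult)
  also have "\<dots> \<le> L2_set (\<lambda>i. cmod (y i)) I * L2_set (\<lambda>i. cmod (z i)) I"
    by (rule L2_set_mult_ineq)
  finally show ?thesis .
qed

lemma L2_set_triangle_sum:
  fixes f :: "'j \<Rightarrow> 'i \<Rightarrow> complex"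
  assumes "finite J"
  shows "L2_set (\<lambda>i. cmod (\<Sum>j\<in>J. f j i)) I \<le> (\<Sum>j\<in>J. L2_set (\<lambda>i. cmod (f j i)) I)"
  using assms
proof (induction J)
  case (insert k J)
  have "L2_set (\<lambda>i. cmod (\<Sum>j\<in>insert k J. f j i)) I \<le>
      L2_set (\<lambda>i. cmod (f k i) + cmod (\<Sum>j\<in>J. f j i)) I"
    using insert by (intro L2_set_mono) (simp_all add: norm_triangle_ineq)
  also have "\<dots> \<le> L2_set (\<lambda>i. cmod (f k i)) I + L2_set (\<lambda>i. cmod (\<Sum>j\<in>J. f j i)) I"
    by (rule L2_set_triangle_ineq)
  finally show ?case using insert by simp
qed (simp add: L2_set_def)

lemma cmod_le_L2_set:
  assumes "finite I" "i \<in> I"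
  shows "cmod (x i) \<le> L2_set (\<lambda>i. cmod (x i)) I"
  using member_le_L2_set[OF assms, of "\<lambda>i. cmod (x i)"] by simp

text \<open>
  The supremum of an unbounded set of reals is an unspecified value, so boundedness comes first.
\<close>

lemma matrix_op_norm_bdd:
  assumes "finite I"
  shows "bdd_above ((\<lambda>x. L2_set (\<lambda>i. cmod (\<Sum>j\<in>I. a i j * x j)) I) `
           {x. L2_set (\<lambda>j. cmod (x j)) I \<le> 1})"
proof (rule bdd_aboveI2)
  fix x :: "'a \<Rightarrow> complex"
  assume x: "x \<in> {x. L2_set (\<lambda>j. cmod (x j)) I \<le> 1}"
  have "L2_set (\<lambda>i. cmod (\<Sum>j\<in>I. a i j * x j)) I \<le> (\<Sum>j\<in>I. L2_set (\<lambda>i. cmod (a i j * x j)) I)"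
    by (rule L2_set_triangle_sum[OF assms])
  also have "\<dots> \<le> (\<Sum>j\<in>I. L2_set (\<lambda>i. cmod (a i j)) I)"
  proof (intro sum_mono L2_set_mono)
    fix i j assume "j \<in> I"
    then have "cmod (x j) \<le> 1"
      using cmod_le_L2_set[OF assms, of j x] x by simp
    then show "cmod (a i j * x j) \<le> cmod (a i j)"
      by (simp add: norm_mult mult_left_le)
  qed simp
  finally show "L2_set (\<lambda>i. cmod (\<Sum>j\<in>I. a i j * x j)) I \<le> (\<Sum>j\<in>I. L2_set (\<lambda>i. cmod (a i j)) I)" .
qed

lemma matrix_op_norm_upper:
  assumes "finite I" "L2_set (\<lambda>j. cmod (x j)) I \<le> 1"
  shows "L2_set (\<lambda>i. cmod (\<Sum>j\<in>I. a i j * x j)) I \<le> matrix_op_norm I a"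
  unfolding matrix_op_norm_def
  by (rule cSUP_upper[OF _ matrix_op_norm_bdd]) (use assms in auto)

lemma matrix_op_norm_nonneg:
  assumes "finite I"
  shows "0 \<le> matrix_op_norm I a"
  using matrix_op_norm_upper[OF assms, of "\<lambda>_. 0" a] by (simp add: L2_set_def)

lemma L2_set_cmod_scale:
  "L2_set (\<lambda>i. cmod (c * x i)) I = cmod c * L2_set (\<lambda>i. cmod (x i)) I"
  by (simp add: norm_mult L2_set_right_distrib)

lemma matrix_op_norm_vector_bound:
  assumes "finite I"
  shows "L2_set (\<lambda>i. cmod (\<Sum>j\<in>I. a i j * x j)) I \<le> matrix_op_norm I a * L2_set (\<lambda>j. cmod (x j)) I"
proof (cases "L2_set (\<lambda>j. cmod (x j)) I = 0")
  case True
  then have "\<And>j. j \<in> I \<Longrightarrow> x j = 0"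
    using assms by (simp add: L2_set_eq_0_iff)
  then have "(\<Sum>j\<in>I. a i j * x j) = 0" for i by (intro sum.neutral) auto
  with True show ?thesis by (simp add: L2_set_def)
next
  case False
  define t where "t = L2_set (\<lambda>j. cmod (x j)) I"
  have t: "t > 0" using False L2_set_nonneg[of "\<lambda>j. cmod (x j)" I] unfolding t_def by linarith
  define c where "c = complex_of_real (1 / t)"
  have c: "cmod c = 1 / t" using t by (simp add: c_def norm_divide)
  have "L2_set (\<lambda>j. cmod (c * x j)) I \<le> 1"
    unfolding L2_set_cmod_scale c using t by (simp add: t_def)
  from matrix_op_norm_upper[OF assms this, of a]
  have "L2_set (\<lambda>i. cmod (c * (\<Sum>j\<in>I. a i j * x j))) I \<le> matrix_op_norm I a"
    by (simp add: sum_distrib_left mult.left_commute)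
  then show ?thesis
    unfolding L2_set_cmod_scale c using t by (simp add: field_simps t_def)
qed

lemma bform_le:
  assumes "finite I"
  shows "cmod (bform I a y x) \<le>
    matrix_op_norm I a * L2_set (\<lambda>j. cmod (y j)) I * L2_set (\<lambda>j. cmod (x j)) I"
proof -
  have "cmod (bform I a y x) \<le> L2_set (\<lambda>j. cmod (y j)) I * L2_set (\<lambda>i. cmod (\<Sum>j\<in>I. a i j * x j)) I"
    unfolding bform_def by (rule cmod_sum_mult_le_L2)
  also have "\<dots> \<le> L2_set (\<lambda>j. cmod (y j)) I * (matrix_op_norm I a * L2_set (\<lambda>j. cmod (x j)) I)"
    by (intro mult_left_mono matrix_op_norm_vector_bound assms L2_set_nonneg)
  finally show ?thesis by (simp add: mult_ac)
qed

text \<open>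
  The extremal \<open>y\<close> is the normalised conjugate of \<open>a x\<close>. Norm bounds are obtained in this form, since
  a bilinear form with integrals as entries is the integral of a bilinear form.
\<close>

lemma matrix_op_norm_leI:
  assumes fin: "finite I"
    and le: "\<And>x y. L2_set (\<lambda>j. cmod (x j)) I \<le> 1 \<Longrightarrow> L2_set (\<lambda>j. cmod (y j)) I \<le> 1 \<Longrightarrow>
               cmod (bform I a y x) \<le> C"
  shows "matrix_op_norm I a \<le> C"
  unfolding matrix_op_norm_def
proof (rule cSUP_least)
  show "{x. L2_set (\<lambda>j. cmod (x j)) I \<le> 1} \<noteq> {}"
    by (auto intro!: exI[of _ "\<lambda>_. 0"] simp: L2_set_def)
  fix x :: "'a \<Rightarrow> complex"
  assume "x \<in> {x. L2_set (\<lambda>j. cmod (x j)) I \<le> 1}"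
  then have x: "L2_set (\<lambda>j. cmod (x j)) I \<le> 1" by simp
  define z where "z i = (\<Sum>j\<in>I. a i j * x j)" for i
  define t where "t = L2_set (\<lambda>i. cmod (z i)) I"
  have C: "0 \<le> C" using le[OF x, of "\<lambda>_. 0"] by (simp add: bform_def L2_set_def)
  have "t \<le> C"
  proof (cases "t = 0")
    case False
    then have t: "t > 0" using L2_set_nonneg[of "\<lambda>j. cmod (z j)" I] unfolding t_def by linarith
    define c where "c = complex_of_real (1 / t)"
    have c: "cmod c = 1 / t" using t by (simp add: c_def norm_divide)
    have "L2_set (\<lambda>j. cmod (c * cnj (z j))) I \<le> 1"
      unfolding L2_set_cmod_scale c using t by (simp add: t_def)
    from le[OF x this]
    have "cmod (\<Sum>i\<in>I. c * cnj (z i) * z i) \<le> C"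
      by (simp add: bform_def z_def)
    also have "(\<Sum>i\<in>I. c * cnj (z i) * z i) = c * of_real (\<Sum>i\<in>I. (cmod (z i))\<^sup>2)"
      unfolding of_real_sum sum_distrib_left
      by (intro sum.cong refl) (simp only: complex_norm_square mult.assoc mult.commute[of "cnj (z _)"])
    also have "(\<Sum>i\<in>I. (cmod (z i))\<^sup>2) = t\<^sup>2"
      unfolding t_def L2_set_def by (simp add: sum_nonneg)
    finally show ?thesis using t by (simp add: norm_mult c power2_eq_square)
  qed (use C in simp)
  then show "L2_set (\<lambda>i. cmod (\<Sum>j\<in>I. a i j * x j)) I \<le> C"
    by (simp add: t_def z_def)
qed

lemma L2_set_reindex:
  assumes "inj_on p J"
  shows "L2_set f (p ` J) = L2_set (\<lambda>j. f (p j)) J"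
  unfolding L2_set_def by (simp add: sum.reindex[OF assms] o_def)

text \<open>
  Used to drop a trivial tensor factor \<open>M\<^sub>1\<close> and to flip the factors of \<open>M\<^sub>n \<otimes> M\<^sub>n\<close>.
\<close>

lemma matrix_op_norm_reindex:
  assumes "bij_betw p J I"
  shows "matrix_op_norm J (\<lambda>i j. a (p i) (p j)) = matrix_op_norm I a"
proof -
  have inj: "inj_on p J" and I: "I = p ` J" using assms by (auto simp: bij_betw_def)
  have eq: "L2_set (\<lambda>i. cmod (\<Sum>j\<in>J. a (p i) (p j) * y (p j))) J = L2_set (\<lambda>i. cmod (\<Sum>j\<in>I. a i j * y j)) I" for y
    unfolding I by (simp add: L2_set_reindex[OF inj] sum.reindex[OF inj] o_def)
  have eq': "L2_set (\<lambda>j. cmod (y (p j))) J = L2_set (\<lambda>j. cmod (y j)) I" for y :: "'b \<Rightarrow> complex"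
    unfolding I by (simp add: L2_set_reindex[OF inj])
  have inv: "x j = (x \<circ> inv_into J p) (p j)" if "j \<in> J" for j and x :: "'a \<Rightarrow> complex"
    using that inj by simp
  show ?thesis
    unfolding matrix_op_norm_def
  proof (rule arg_cong[where f = Sup], intro equalityI subsetI)
    fix t assume "t \<in> (\<lambda>x. L2_set (\<lambda>i. cmod (\<Sum>j\<in>J. a (p i) (p j) * x j)) J) ` {x. L2_set (\<lambda>j. cmod (x j)) J \<le> 1}"
    then obtain x where x: "L2_set (\<lambda>j. cmod (x j)) J \<le> 1"
      and t: "t = L2_set (\<lambda>i. cmod (\<Sum>j\<in>J. a (p i) (p j) * x j)) J" by auto
    define y where "y = x \<circ> inv_into J p"
    have xy: "x j = y (p j)" if "j \<in> J" for j unfolding y_def by (rule inv[OF that])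
    have "L2_set (\<lambda>j. cmod (x j)) J = L2_set (\<lambda>j. cmod (y (p j))) J"
      by (rule L2_set_cong) (simp_all add: xy)
    with x have "L2_set (\<lambda>j. cmod (y j)) I \<le> 1" by (simp add: eq')
    moreover have "t = L2_set (\<lambda>i. cmod (\<Sum>j\<in>J. a (p i) (p j) * y (p j))) J"
      unfolding t by (intro L2_set_cong refl arg_cong[where f = cmod] sum.cong) (simp_all add: xy)
    ultimately show "t \<in> (\<lambda>x. L2_set (\<lambda>i. cmod (\<Sum>j\<in>I. a i j * x j)) I) ` {x. L2_set (\<lambda>j. cmod (x j)) I \<le> 1}"
      by (auto simp: eq)
  next
    fix t assume "t \<in> (\<lambda>x. L2_set (\<lambda>i. cmod (\<Sum>j\<in>I. a i j * x j)) I) ` {x. L2_set (\<lambda>j. cmod (x j)) I \<le> 1}"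
    then obtain y where "L2_set (\<lambda>j. cmod (y j)) I \<le> 1" "t = L2_set (\<lambda>i. cmod (\<Sum>j\<in>I. a i j * y j)) I" by auto
    then show "t \<in> (\<lambda>x. L2_set (\<lambda>i. cmod (\<Sum>j\<in>J. a (p i) (p j) * x j)) J) ` {x. L2_set (\<lambda>j. cmod (x j)) J \<le> 1}"
      by (intro image_eqI[of _ _ "y \<circ> p"]) (simp_all add: eq eq')
  qed
qed

lemma bform_scale: "bform I (\<lambda>i j. c * a i j) y x = c * bform I a y x"
  unfolding bform_def by (simp add: sum_distrib_left mult_ac)

lemma matrix_op_norm_scale_le:
  assumes "finite I"
  shows "matrix_op_norm I (\<lambda>i j. c * a i j) \<le> cmod c * matrix_op_norm I a"
proof (rule matrix_op_norm_leI[OF assms])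
  fix x y :: "'a \<Rightarrow> complex"
  assume x: "L2_set (\<lambda>j. cmod (x j)) I \<le> 1" and y: "L2_set (\<lambda>j. cmod (y j)) I \<le> 1"
  have "cmod (bform I a y x) \<le> matrix_op_norm I a * L2_set (\<lambda>j. cmod (y j)) I * L2_set (\<lambda>j. cmod (x j)) I"
    by (rule bform_le[OF assms])
  also have "\<dots> \<le> matrix_op_norm I a * 1 * 1"
    using x y matrix_op_norm_nonneg[OF assms] by (intro mult_mono) (auto simp: L2_set_nonneg)
  finally show "cmod (bform I (\<lambda>i j. c * a i j) y x) \<le> cmod c * matrix_op_norm I a"
    unfolding bform_scale norm_mult by (simp add: mult_left_mono)
qed

lemma matrix_op_norm_cnj:
  "matrix_op_norm I (\<lambda>i j. cnj (a i j)) = matrix_op_norm I a"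
proof -
  have eq: "L2_set (\<lambda>i. cmod (\<Sum>j\<in>I. cnj (a i j) * cnj (x j))) I = L2_set (\<lambda>i. cmod (\<Sum>j\<in>I. a i j * x j)) I" for x
  proof (intro L2_set_cong refl)
    fix i
    have "(\<Sum>j\<in>I. cnj (a i j) * cnj (x j)) = cnj (\<Sum>j\<in>I. a i j * x j)" by simp
    then show "cmod (\<Sum>j\<in>I. cnj (a i j) * cnj (x j)) = cmod (\<Sum>j\<in>I. a i j * x j)"
      by (simp only: complex_mod_cnj)
  qed
  have "(\<lambda>x. L2_set (\<lambda>i. cmod (\<Sum>j\<in>I. cnj (a i j) * x j)) I) ` {x. L2_set (\<lambda>j. cmod (x j)) I \<le> 1}
    = (\<lambda>x. L2_set (\<lambda>i. cmod (\<Sum>j\<in>I. cnj (a i j) * x j)) I) ` ((\<lambda>x j. cnj (x j)) ` {x. L2_set (\<lambda>j. cmod (x j)) I \<le> 1})"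
  proof -
    have "{x. L2_set (\<lambda>j. cmod (x j)) I \<le> 1} = (\<lambda>x j. cnj (x j)) ` {x. L2_set (\<lambda>j. cmod (x j)) I \<le> 1}"
    proof (intro equalityI subsetI)
      fix x :: "'a \<Rightarrow> complex" assume "x \<in> {x. L2_set (\<lambda>j. cmod (x j)) I \<le> 1}"
      then show "x \<in> (\<lambda>x j. cnj (x j)) ` {x. L2_set (\<lambda>j. cmod (x j)) I \<le> 1}"
        by (intro image_eqI[of _ _ "\<lambda>j. cnj (x j)"]) auto
    qed auto
    then show ?thesis by simp
  qed
  also have "\<dots> = (\<lambda>x. L2_set (\<lambda>i. cmod (\<Sum>j\<in>I. a i j * x j)) I) ` {x. L2_set (\<lambda>j. cmod (x j)) I \<le> 1}"
    unfolding image_image by (simp add: eq)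
  finally show ?thesis unfolding matrix_op_norm_def by simp
qed

lemma matrix_op_norm_singleton: "matrix_op_norm {i} a = cmod (a i i)"
proof (rule antisym)
  show "matrix_op_norm {i} a \<le> cmod (a i i)"
  proof (rule matrix_op_norm_leI)
    fix x y :: "'a \<Rightarrow> complex"
    assume "L2_set (\<lambda>j. cmod (x j)) {i} \<le> 1" "L2_set (\<lambda>j. cmod (y j)) {i} \<le> 1"
    then have "cmod (y i) * (cmod (a i i) * cmod (x i)) \<le> 1 * (cmod (a i i) * 1)"
      by (intro mult_mono) (auto simp: L2_set_def)
    then show "cmod (bform {i} a y x) \<le> cmod (a i i)"
      by (simp add: bform_def norm_mult)
  qed simp
  show "cmod (a i i) \<le> matrix_op_norm {i} a"
    using matrix_op_norm_upper[of "{i}" "\<lambda>_. 1" a] by (simp add: L2_set_def)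
qed

lemma matrix_op_norm_lim_le:
  assumes fin: "finite I" and "F \<noteq> bot"
    and lim: "\<And>i j. i \<in> I \<Longrightarrow> j \<in> I \<Longrightarrow> ((\<lambda>t. b t i j) \<longlongrightarrow> a i j) F"
    and le: "eventually (\<lambda>t. matrix_op_norm I (b t) \<le> C) F"
  shows "matrix_op_norm I a \<le> C"
proof (rule matrix_op_norm_leI[OF fin])
  fix x y :: "'a \<Rightarrow> complex"
  assume x: "L2_set (\<lambda>j. cmod (x j)) I \<le> 1" and y: "L2_set (\<lambda>j. cmod (y j)) I \<le> 1"
  have "((\<lambda>t. cmod (bform I (b t) y x)) \<longlongrightarrow> cmod (bform I a y x)) F"
    unfolding bform_def by (intro tendsto_intros lim)
  moreover have "eventually (\<lambda>t. cmod (bform I (b t) y x) \<le> C) F"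
    using le
  proof eventually_elim
    case (elim t)
    have "cmod (bform I (b t) y x) \<le> matrix_op_norm I (b t) * L2_set (\<lambda>j. cmod (y j)) I * L2_set (\<lambda>j. cmod (x j)) I"
      by (rule bform_le[OF fin])
    also have "\<dots> \<le> matrix_op_norm I (b t) * 1 * 1"
      using x y matrix_op_norm_nonneg[OF fin] by (intro mult_mono) (auto simp: L2_set_nonneg)
    finally show ?case using elim by simp
  qed
  ultimately show "cmod (bform I a y x) \<le> C"
    using tendsto_upperbound \<open>F \<noteq> bot\<close> by blast
qed

text \<open>
  A crude perturbation bound: it only serves to make the norm continuous in the entries.
\<close>

lemma matrix_op_norm_triangle:
  assumes "finite I"
  shows "matrix_op_norm I a \<le> matrix_op_norm I b + (\<Sum>i\<in>I. \<Sum>j\<in>I. cmod (a i j - b i j))"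
proof (rule matrix_op_norm_leI[OF assms])
  fix x y :: "'a \<Rightarrow> complex"
  assume x: "L2_set (\<lambda>j. cmod (x j)) I \<le> 1" and y: "L2_set (\<lambda>j. cmod (y j)) I \<le> 1"
  have "cmod (bform I b y x) \<le> matrix_op_norm I b * L2_set (\<lambda>j. cmod (y j)) I * L2_set (\<lambda>j. cmod (x j)) I"
    by (rule bform_le[OF assms])
  also have "\<dots> \<le> matrix_op_norm I b * 1 * 1"
    using x y matrix_op_norm_nonneg[OF assms] by (intro mult_mono) (auto simp: L2_set_nonneg)
  finally have 1: "cmod (bform I b y x) \<le> matrix_op_norm I b" by simp
  have "bform I a y x = bform I b y x + (\<Sum>i\<in>I. \<Sum>j\<in>I. y i * ((a i j - b i j) * x j))"
    unfolding bform_def by (simp add: sum.distrib[symmetric] sum_distrib_left algebra_simps)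
  moreover have "cmod (\<Sum>i\<in>I. \<Sum>j\<in>I. y i * ((a i j - b i j) * x j)) \<le> (\<Sum>i\<in>I. \<Sum>j\<in>I. cmod (a i j - b i j))"
  proof (intro order_trans[OF norm_sum] sum_mono)
    fix i j assume ij: "i \<in> I" "j \<in> I"
    have "cmod (y i) \<le> 1" "cmod (x j) \<le> 1"
      using cmod_le_L2_set[OF assms ij(1), of y] cmod_le_L2_set[OF assms ij(2), of x] x y by auto
    then have "cmod (y i) * (cmod (a i j - b i j) * cmod (x j)) \<le> 1 * (cmod (a i j - b i j) * 1)"
      by (intro mult_mono) auto
    then show "cmod (y i * ((a i j - b i j) * x j)) \<le> cmod (a i j - b i j)"
      by (simp add: norm_mult)
  qed
  ultimately show "cmod (bform I a y x) \<le> matrix_op_norm I b + (\<Sum>i\<in>I. \<Sum>j\<in>I. cmod (a i j - b i j))"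
    using 1 norm_triangle_ineq[of "bform I b y x" "\<Sum>i\<in>I. \<Sum>j\<in>I. y i * ((a i j - b i j) * x j)"] by simp
qed

text \<open>
  The essential supremum defining \<open>M\<^sub>n(L\<^sup>\<infinity>)\<close> requires a measurable norm function, which is a
  supremum over uncountably many vectors; for continuous entries continuity settles this.
\<close>

lemma continuous_on_matrix_op_norm:
  fixes g :: "'i \<Rightarrow> 'i \<Rightarrow> 'a::metric_space \<Rightarrow> complex"
  assumes fin: "finite I" and cont: "\<And>i j. i \<in> I \<Longrightarrow> j \<in> I \<Longrightarrow> continuous_on S (g i j)"
  shows "continuous_on S (\<lambda>s. matrix_op_norm I (\<lambda>i j. g i j s))"
  unfolding continuous_on_def
proof
  fix s assume s: "s \<in> S"
  have le: "norm (matrix_op_norm I (\<lambda>i j. g i j t) - matrix_op_norm I (\<lambda>i j. g i j s))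
      \<le> (\<Sum>i\<in>I. \<Sum>j\<in>I. cmod (g i j t - g i j s))" for t
    using matrix_op_norm_triangle[OF fin, of "\<lambda>i j. g i j t" "\<lambda>i j. g i j s"]
      matrix_op_norm_triangle[OF fin, of "\<lambda>i j. g i j s" "\<lambda>i j. g i j t"]
    by (simp add: abs_le_iff norm_minus_commute)
  have "((\<lambda>t. g i j t) \<longlongrightarrow> g i j s) (at s within S)" if "i \<in> I" "j \<in> I" for i j
    using cont[OF that] s by (auto simp: continuous_on_def)
  then have "((\<lambda>t. \<Sum>i\<in>I. \<Sum>j\<in>I. cmod (g i j t - g i j s)) \<longlongrightarrow> (\<Sum>i\<in>I. \<Sum>j\<in>I. cmod (g i j s - g i j s))) (at s within S)"
    by (intro tendsto_sum tendsto_norm tendsto_diff tendsto_const)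
  then have lim0: "((\<lambda>t. \<Sum>i\<in>I. \<Sum>j\<in>I. cmod (g i j t - g i j s)) \<longlongrightarrow> 0) (at s within S)"
    by simp
  have "((\<lambda>t. matrix_op_norm I (\<lambda>i j. g i j t) - matrix_op_norm I (\<lambda>i j. g i j s)) \<longlongrightarrow> 0) (at s within S)"
    by (rule Lim_null_comparison[OF always_eventually lim0]) (rule allI, rule le)
  then show "((\<lambda>s. matrix_op_norm I (\<lambda>i j. g i j s)) \<longlongrightarrow> matrix_op_norm I (\<lambda>i j. g i j s)) (at s within S)"
    by (simp add: LIM_zero_iff)
qed

section \<open>The circle\<close>

lemma space_circle_measure [simp]: "space circle_measure = sphere 0 1"
  by (simp add: circle_measure_def space_restrict_space)

lemma sets_circle_measure [measurable_cong]: "sets circle_measure = sets (restrict_space borel (sphere 0 1))"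
  by (simp add: circle_measure_def)

lemma continuous_on_sphere_imp_measurable:
  fixes g :: "complex \<Rightarrow> 'b::topological_space"
  assumes "continuous_on (sphere 0 1) g"
  shows "g \<in> borel_measurable circle_measure"
  using borel_measurable_continuous_on_restrict[OF assms]
    measurable_cong_sets[OF sets_circle_measure refl, of borel] by auto

text \<open>
  The parameter interval with normalised Lebesgue measure, of which the circle is the image under \<open>cis\<close>.
\<close>

definition arc_measure :: "real measure" where
  "arc_measure = density (restrict_space lborel {0..2 * pi}) (\<lambda>_. ennreal (1 / (2 * pi)))"

lemma circle_measure_eq_distr: "circle_measure = distr arc_measure (restrict_space borel (sphere 0 1)) cis"
  by (simp add: circle_measure_def arc_measure_def)

lemma measurable_cis_sphere: "cis \<in> arc_measure \<rightarrow>\<^sub>M restrict_space borel (sphere 0 1)"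
proof (rule measurable_restrict_space2)
  have "cis \<in> borel_measurable borel"
    by (intro borel_measurable_continuous_onI continuous_on_cis continuous_on_id)
  then show "cis \<in> borel_measurable arc_measure"
    by (simp add: arc_measure_def measurable_restrict_space1)
qed auto

lemma prob_space_circle_measure: "prob_space circle_measure"
proof
  have "emeasure arc_measure {0..2*pi} = 1"
  proof -
    have "emeasure arc_measure {0..2*pi} =
        (\<integral>\<^sup>+x. ennreal (1 / (2*pi)) * indicator {0..2*pi} x \<partial>restrict_space lborel {0..2*pi})"
      unfolding arc_measure_def by (subst emeasure_density) (auto simp: sets_restrict_space_iff)
    also have "\<dots> = ennreal (1 / (2*pi)) * emeasure (restrict_space lborel {0..2*pi}) {0..2*pi}"
      by (rule nn_integral_cmult_indicator) (simp add: sets_restrict_space_iff)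
    also have "emeasure (restrict_space lborel {0..2*pi}) {0..2*pi} = ennreal (2*pi)"
      by (subst emeasure_restrict_space) auto
    finally show ?thesis by (simp flip: ennreal_mult)
  qed
  moreover have "space arc_measure = {0..2*pi}"
    by (simp add: arc_measure_def space_restrict_space)
  moreover have "cis -` sphere 0 1 \<inter> {0..2*pi} = {0..2*pi}" by auto
  ultimately show "emeasure circle_measure (space circle_measure) = 1"
    unfolding space_circle_measure
    unfolding circle_measure_eq_distr
    by (subst emeasure_distr[OF measurable_cis_sphere]) (simp_all add: sets_restrict_space_iff)
qed

interpretation circle: prob_space circle_measure
  by (rule prob_space_circle_measure)

lemma integral_powi_circle:
  "(LINT \<zeta>|circle_measure. \<zeta> powi k) = (if k = 0 then 1 else 0)"
proof (cases "k = 0")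
  case True
  then show ?thesis using circle.prob_space by simp
next
  case False
  have cont: "continuous_on (sphere 0 1) (\<lambda>\<zeta>::complex. \<zeta> powi k)"
    by (intro continuous_intros) auto
  then have m: "(\<lambda>\<zeta>. \<zeta> powi k) \<in> borel_measurable (restrict_space borel (sphere (0::complex) 1))"
    by (rule borel_measurable_continuous_on_restrict)
  have "(LINT \<zeta>|circle_measure. \<zeta> powi k) = (LINT t|arc_measure. cis t powi k)"
    unfolding circle_measure_eq_distr by (rule integral_distr[OF measurable_cis_sphere m])
  also have "\<dots> = (LINT t|arc_measure. cis (of_int k * t))"
    by (simp add: Complex.cis_power_int)
  also have "\<dots> = (LINT t|restrict_space lborel {0..2*pi}. (1 / (2*pi)) *\<^sub>R cis (of_int k * t))"
    unfolding arc_measure_def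
  proof (rule integral_density)
    have "(\<lambda>t. cis (of_int k * t)) \<in> borel_measurable borel"
      by (intro borel_measurable_continuous_onI continuous_intros)
    then show "(\<lambda>t. cis (of_int k * t)) \<in> borel_measurable (restrict_space lborel {0..2*pi})"
      by (simp add: measurable_restrict_space1)
  qed auto
  also have "\<dots> = (LINT t|lborel. indicator {0..2*pi} t *\<^sub>R ((1 / (2*pi)) *\<^sub>R cis (of_int k * t)))"
    by (subst integral_restrict_space) auto
  also have "\<dots> = (\<lambda>t. cis (of_int k * t) / (2 * pi * \<i> * k)) (2 * pi) - (\<lambda>t. cis (of_int k * t) / (2 * pi * \<i> * k)) 0"
  proof (rule integral_FTC_Icc)
    show "((\<lambda>t. cis (of_int k * t) / (2 * pi * \<i> * k)) has_vector_derivative (1 / (2*pi)) *\<^sub>R cis (of_int k * t)) (at t within {0..2*pi})" for t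
      using False
      by (auto intro!: derivative_eq_intros simp: has_vector_derivative_def field_simps scaleR_conv_of_real fun_eq_iff)
    show "continuous_on {0..2*pi} (\<lambda>t. (1 / (2*pi)) *\<^sub>R cis (of_int k * t))"
      by (intro continuous_intros)
  qed simp
  also have "\<dots> = 0"
    using cis_multiple_2pi[of "of_int k"] by (simp add: mult.commute mult.left_commute)
  finally show ?thesis using False by simp
qed

lemma integrable_mult_bounded:
  fixes f g :: "complex \<Rightarrow> complex"
  assumes "integrable M f" "g \<in> borel_measurable M" "\<And>x. x \<in> space M \<Longrightarrow> cmod (g x) \<le> B"
  shows "integrable M (\<lambda>x. f x * g x)"
proof (rule Bochner_Integration.integrable_bound)
  show "integrable M (\<lambda>x. B * norm (f x))" using assms by auto
  show "AE x in M. norm (f x * g x) \<le> norm (B * norm (f x))"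
  proof (rule AE_I2)
    fix x assume "x \<in> space M"
    then have "cmod (g x) \<le> B" by (rule assms)
    moreover then have "0 \<le> B" using norm_ge_zero order_trans by blast
    ultimately show "norm (f x * g x) \<le> norm (B * norm (f x))"
      by (simp add: norm_mult abs_mult mult.commute[of B] mult_left_mono)
  qed
qed (use assms in measurable)

lemma cmod_integral_mult_le:
  fixes f g :: "complex \<Rightarrow> complex"
  assumes "integrable M f" "g \<in> borel_measurable M" "\<And>x. x \<in> space M \<Longrightarrow> cmod (g x) \<le> B"
  shows "cmod (LINT x|M. f x * g x) \<le> B * (LINT x|M. cmod (f x))"
proof -
  have "cmod (LINT x|M. f x * g x) \<le> (LINT x|M. B * cmod (f x))"
  proof (rule Bochner_Integration.integral_norm_bound_integral)
    show "integrable M (\<lambda>x. f x * g x)" by (rule integrable_mult_bounded[OF assms])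
    show "integrable M (\<lambda>x. B * cmod (f x))" using assms by auto
  qed (use assms in \<open>simp add: norm_mult mult.commute[of B] mult_left_mono\<close>)
  then show ?thesis by simp
qed

lemma cmod_fourier_coeff_le:
  assumes "integrable circle_measure f"
  shows "cmod (fourier_coeff f k) \<le> (LINT \<zeta>|circle_measure. cmod (f \<zeta>))"
proof -
  have "cmod (LINT \<zeta>|circle_measure. f \<zeta> * \<zeta> powi (- k)) \<le> 1 * (LINT \<zeta>|circle_measure. cmod (f \<zeta>))"
    by (rule cmod_integral_mult_le[OF assms])
      (auto intro!: continuous_on_sphere_imp_measurable continuous_intros simp: norm_power_int)
  then show ?thesis by (simp add: fourier_coeff_def)
qed

lemma esssup_circle_le:
  assumes "continuous_on (sphere 0 1) h" "\<And>\<zeta>. cmod \<zeta> = 1 \<Longrightarrow> h \<zeta> \<le> (C::real)"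
  shows "esssup circle_measure (\<lambda>\<zeta>. ennreal (h \<zeta>)) \<le> ennreal C"
proof (rule esssup_I)
  show "(\<lambda>\<zeta>. ennreal (h \<zeta>)) \<in> borel_measurable circle_measure"
    using continuous_on_sphere_imp_measurable[OF assms(1)] by measurable
  show "AE \<zeta> in circle_measure. ennreal (h \<zeta>) \<le> ennreal C"
    using assms(2) by (intro AE_I2 ennreal_leI) auto
qed

lemma continuous_mem_circle_Linf:
  assumes "continuous_on (sphere 0 1) g"
  shows "g \<in> circle_Linf"
proof -
  have "compact (g ` sphere 0 1)"
    by (intro compact_continuous_image assms) auto
  then obtain C where C: "\<And>\<zeta>. cmod \<zeta> = 1 \<Longrightarrow> cmod (g \<zeta>) \<le> C"
    using compact_imp_bounded bounded_iff by (metis dist_0_norm imageI mem_sphere)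
  have "esssup circle_measure (\<lambda>\<zeta>. ennreal (cmod (g \<zeta>))) \<le> ennreal C"
    by (rule esssup_circle_le) (use C assms in \<open>auto intro: continuous_intros\<close>)
  then show ?thesis
    using continuous_on_sphere_imp_measurable[OF assms]
    by (auto simp: circle_Linf_def intro: le_less_trans)
qed

text \<open>
  The operator space structure of \<open>L\<^sup>1\<close> in the form in which it is used: \<open>f\<close> acts as a complete
  contraction from \<open>L\<^sup>\<infinity>\<close> to \<open>M\<^sub>n\<close>. Continuous test matrices are enough, because
  all kernels below are smoothed.
\<close>

lemma integral_against_continuous_le_L1_norm:
  fixes m :: nat
  assumes cont: "\<And>k l. k < m \<Longrightarrow> l < m \<Longrightarrow> continuous_on (sphere 0 1) (g k l)"
    and le: "\<And>\<zeta>. cmod \<zeta> = 1 \<Longrightarrow> matrix_op_norm {..<m} (\<lambda>k l. g k l \<zeta>) \<le> 1"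
    and f: "L1_matrix_norm n f \<le> 1"
  shows "matrix_op_norm ({..<m} \<times> {..<n})
           (\<lambda>(k, i) (l, j). LINT \<zeta>|circle_measure. f i j \<zeta> * g k l \<zeta>) \<le> 1"
proof -
  have "esssup circle_measure (\<lambda>\<zeta>. ennreal (matrix_op_norm {..<m} (\<lambda>k l. g k l \<zeta>))) \<le> ennreal 1"
  proof (rule esssup_circle_le)
    show "continuous_on (sphere 0 1) (\<lambda>\<zeta>. matrix_op_norm {..<m} (\<lambda>k l. g k l \<zeta>))"
      by (rule continuous_on_matrix_op_norm) (auto intro: cont)
  qed (rule le)
  then have "Mn_matrix_norm n m (\<lambda>k l i j. LINT \<zeta>|circle_measure. f i j \<zeta> * g k l \<zeta>) \<le> L1_matrix_norm n f"
    unfolding L1_matrix_norm_def cb_norm_def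
    by (intro SUP_upper2[of "(m, g)"])
       (auto simp: Linf_matrix_norm_def intro!: continuous_mem_circle_Linf cont)
  also note f
  finally show ?thesis
    by (simp add: Mn_matrix_norm_def split_def)
qed

section \<open>Moments of the disk\<close>

text \<open>
  Lebesgue measure on the plane as a product, which gives access to Fubini's theorem.
\<close>

lemma lborel_complex_eq_distr:
  "(lborel :: complex measure) = distr (lborel \<Otimes>\<^sub>M lborel) borel (\<lambda>(x, y). Complex x y)"
proof (rule lborel_eqI)
  have [measurable]: "(\<lambda>(x, y). Complex x y) \<in> borel_measurable (borel \<Otimes>\<^sub>M borel)"
    unfolding borel_prod split_def by (intro borel_measurable_continuous_onI continuous_intros)
  fix l u :: complex
  assume le: "\<And>b. b \<in> Basis \<Longrightarrow> l \<bullet> b \<le> u \<bullet> b"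
  from le[of 1] le[of \<i>] have lu: "Re l \<le> Re u" "Im l \<le> Im u" by (auto simp: Basis_complex_def)
  have "(\<lambda>(x, y). Complex x y) -` box l u = box (Re l) (Re u) \<times> box (Im l) (Im u)"
    by (auto simp: box_def Basis_complex_def)
  then have "emeasure (distr (lborel \<Otimes>\<^sub>M lborel) borel (\<lambda>(x, y). Complex x y)) (box l u)
      = emeasure (lborel \<Otimes>\<^sub>M lborel) (box (Re l) (Re u) \<times> box (Im l) (Im u))"
    by (subst emeasure_distr) (auto simp: space_pair_measure)
  also have "\<dots> = emeasure lborel (box (Re l) (Re u)) * emeasure lborel (box (Im l) (Im u))"
    by (rule lborel.emeasure_pair_measure_Times) auto
  also have "\<dots> = (\<Prod>b\<in>Basis. (u - l) \<bullet> b)"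
    using lu by (simp add: Basis_complex_def ennreal_mult)
  finally show "emeasure (distr (lborel \<Otimes>\<^sub>M lborel) borel (\<lambda>(x, y). Complex x y)) (box l u) = (\<Prod>b\<in>Basis. (u - l) \<bullet> b)" .
qed simp

lemma nn_integral_lborel_complex:
  assumes [measurable]: "f \<in> borel_measurable borel"
  shows "(\<integral>\<^sup>+z. f z \<partial>lborel) = (\<integral>\<^sup>+x. \<integral>\<^sup>+y. f (Complex x y) \<partial>lborel \<partial>lborel)"
    and "(\<integral>\<^sup>+z. f z \<partial>lborel) = (\<integral>\<^sup>+y. \<integral>\<^sup>+x. f (Complex x y) \<partial>lborel \<partial>lborel)"
proof -
  have [measurable]: "(\<lambda>(x, y). Complex x y) \<in> borel_measurable (borel \<Otimes>\<^sub>M borel)"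
    unfolding borel_prod split_def by (intro borel_measurable_continuous_onI continuous_intros)
  have m: "(\<lambda>(x, y). f (Complex x y)) \<in> borel_measurable (borel \<Otimes>\<^sub>M borel)"
    using measurable_compose[of "\<lambda>(x, y). Complex x y" "borel \<Otimes>\<^sub>M borel" borel f borel] by (simp add: split_def)
  then have m': "(\<lambda>(x, y). f (Complex x y)) \<in> borel_measurable (lborel \<Otimes>\<^sub>M lborel)" by simp
  have "(\<integral>\<^sup>+z. f z \<partial>lborel) = (\<integral>\<^sup>+p. f (case p of (x, y) \<Rightarrow> Complex x y) \<partial>(lborel \<Otimes>\<^sub>M lborel))"
    by (subst lborel_complex_eq_distr, subst nn_integral_distr) auto
  then have eq: "(\<integral>\<^sup>+z. f z \<partial>lborel) = (\<integral>\<^sup>+(x, y). f (Complex x y) \<partial>(lborel \<Otimes>\<^sub>M lborel))"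
    by (simp add: split_def)
  show "(\<integral>\<^sup>+z. f z \<partial>lborel) = (\<integral>\<^sup>+x. \<integral>\<^sup>+y. f (Complex x y) \<partial>lborel \<partial>lborel)"
    unfolding eq by (subst lborel.nn_integral_fst[OF m', symmetric]) simp
  show "(\<integral>\<^sup>+z. f z \<partial>lborel) = (\<integral>\<^sup>+y. \<integral>\<^sup>+x. f (Complex x y) \<partial>lborel \<partial>lborel)"
    unfolding eq by (subst lborel_pair.nn_integral_snd[OF m', symmetric]) simp
qed

text \<open>
  A rotation \<open>(x, y) \<mapsto> (a x - b y, b x + a y)\<close> is the composition of \<open>(x, y) \<mapsto> (a x - b y, y)\<close> and
  \<open>(x, y) \<mapsto> (x, (b / a) x + y / a)\<close>. Each of them is affine in one variable, and the Jacobians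
  \<open>a\<close> and \<open>1 / a\<close> cancel; this needs \<open>a \<noteq> 0\<close>.
\<close>

lemma nn_integral_rotate:
  assumes f[measurable]: "f \<in> borel_measurable borel" and w: "cmod w = 1" "Re w \<noteq> 0"
  shows "(\<integral>\<^sup>+z. f (w * z) \<partial>lborel) = (\<integral>\<^sup>+z. f z \<partial>lborel)"
proof -
  define a where "a = Re w"
  define b where "b = Im w"
  have a: "a \<noteq> 0" and ab: "a\<^sup>2 + b\<^sup>2 = 1"
    using w by (auto simp: a_def b_def cmod_def)
  have [measurable]: "(\<lambda>(x, y). Complex x y) \<in> borel_measurable (borel \<Otimes>\<^sub>M borel)"
    unfolding borel_prod split_def by (intro borel_measurable_continuous_onI continuous_intros)
  have mC: "(\<lambda>t. Complex (g t) (h t)) \<in> borel_measurable M"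
    if [measurable]: "g \<in> borel_measurable M" "h \<in> borel_measurable M" for g h and M :: "'x measure"
    using measurable_compose[of "\<lambda>t. (g t, h t)" M "borel \<Otimes>\<^sub>M borel" "\<lambda>(x, y). Complex x y" borel] by simp
  have mf: "(\<lambda>t. f (Complex (g t) (h t))) \<in> borel_measurable M"
    if "g \<in> borel_measurable M" "h \<in> borel_measurable M" for g h and M :: "'x measure"
    by (rule measurable_compose[OF mC[OF that] f])
  have wz: "w * Complex x y = Complex (a * x - b * y) (b * x + a * y)" for x y
    by (simp add: complex_eq_iff a_def b_def)
  have *: "b * x + a * y = (b / a) * (a * x - b * y) + (1 / a) * y" for x y
  proof -
    have "(b / a) * (a * x - b * y) + (1 / a) * y = b * x + ((1 - b\<^sup>2) / a) * y"
      using a by (simp add: field_simps power2_eq_square)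
    also have "1 - b\<^sup>2 = a\<^sup>2" using ab by simp
    finally show ?thesis using a by (simp add: power2_eq_square)
  qed
  have q: "(\<lambda>(y, x). f (Complex x ((b / a) * x + (1 / a) * y))) \<in> borel_measurable (lborel \<Otimes>\<^sub>M lborel)"
    "(\<lambda>(x, y). f (Complex x ((b / a) * x + (1 / a) * y))) \<in> borel_measurable (lborel \<Otimes>\<^sub>M lborel)"
    "(\<lambda>(x, y). f (Complex x y)) \<in> borel_measurable (lborel \<Otimes>\<^sub>M lborel)"
    unfolding split_def by (intro mf; measurable)+
  have mw: "(\<lambda>z. f (w * z)) \<in> borel_measurable borel" by measurable
  have "(\<integral>\<^sup>+z. f (w * z) \<partial>lborel) = (\<integral>\<^sup>+y. \<integral>\<^sup>+x. f (w * Complex x y) \<partial>lborel \<partial>lborel)"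
    by (rule nn_integral_lborel_complex(2)[OF mw])
  also have "\<dots> = (\<integral>\<^sup>+y. \<integral>\<^sup>+x. f (Complex (a * x - b * y) ((b / a) * (a * x - b * y) + (1 / a) * y)) \<partial>lborel \<partial>lborel)"
    unfolding wz * ..
  also have "\<dots> = (\<integral>\<^sup>+y. ennreal \<bar>1 / a\<bar> * (\<integral>\<^sup>+x. f (Complex x ((b / a) * x + (1 / a) * y)) \<partial>lborel) \<partial>lborel)"
  proof (rule nn_integral_cong)
    fix y :: real
    have "(\<integral>\<^sup>+x. f (Complex x ((b / a) * x + (1 / a) * y)) \<partial>lborel)
       = ennreal \<bar>a\<bar> * (\<integral>\<^sup>+x. f (Complex (- b * y + a * x) ((b / a) * (- b * y + a * x) + (1 / a) * y)) \<partial>lborel)"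
      by (rule nn_integral_real_affine) (auto intro!: mf simp: a)
    then have "ennreal \<bar>1 / a\<bar> * (\<integral>\<^sup>+x. f (Complex x ((b / a) * x + (1 / a) * y)) \<partial>lborel)
      = ennreal \<bar>1 / a\<bar> * ennreal \<bar>a\<bar> * (\<integral>\<^sup>+x. f (Complex (- b * y + a * x) ((b / a) * (- b * y + a * x) + (1 / a) * y)) \<partial>lborel)"
      by (simp add: mult.assoc)
    also have "ennreal \<bar>1 / a\<bar> * ennreal \<bar>a\<bar> = 1"
      using a by (simp flip: ennreal_mult add: abs_mult[symmetric])
    finally show "(\<integral>\<^sup>+x. f (Complex (a * x - b * y) ((b / a) * (a * x - b * y) + (1 / a) * y)) \<partial>lborel)
      = ennreal \<bar>1 / a\<bar> * (\<integral>\<^sup>+x. f (Complex x ((b / a) * x + (1 / a) * y)) \<partial>lborel)"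
      by (simp add: algebra_simps)
  qed
  also have "\<dots> = ennreal \<bar>1 / a\<bar> * (\<integral>\<^sup>+y. \<integral>\<^sup>+x. f (Complex x ((b / a) * x + (1 / a) * y)) \<partial>lborel \<partial>lborel)"
    by (rule nn_integral_cmult) (rule lborel.borel_measurable_nn_integral[OF q(1)])
  also have "(\<integral>\<^sup>+y. \<integral>\<^sup>+x. f (Complex x ((b / a) * x + (1 / a) * y)) \<partial>lborel \<partial>lborel)
     = (\<integral>\<^sup>+x. \<integral>\<^sup>+y. f (Complex x ((b / a) * x + (1 / a) * y)) \<partial>lborel \<partial>lborel)"
    by (rule lborel_pair.Fubini'[OF q(2)])
  also have "\<dots> = (\<integral>\<^sup>+x. ennreal \<bar>a\<bar> * (\<integral>\<^sup>+y. f (Complex x y) \<partial>lborel) \<partial>lborel)"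
  proof (rule nn_integral_cong)
    fix x :: real
    have "(\<integral>\<^sup>+y. f (Complex x y) \<partial>lborel) = ennreal \<bar>1 / a\<bar> * (\<integral>\<^sup>+y. f (Complex x ((b / a) * x + (1 / a) * y)) \<partial>lborel)"
      by (rule nn_integral_real_affine) (auto intro!: mf simp: a)
    then have "ennreal \<bar>a\<bar> * (\<integral>\<^sup>+y. f (Complex x y) \<partial>lborel)
       = ennreal \<bar>a\<bar> * ennreal \<bar>1 / a\<bar> * (\<integral>\<^sup>+y. f (Complex x ((b / a) * x + (1 / a) * y)) \<partial>lborel)"
      by (simp add: mult.assoc)
    also have "ennreal \<bar>a\<bar> * ennreal \<bar>1 / a\<bar> = 1"
      using a by (simp flip: ennreal_mult add: abs_mult[symmetric])
    finally show "(\<integral>\<^sup>+y. f (Complex x ((b / a) * x + (1 / a) * y)) \<partial>lborel)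
       = ennreal \<bar>a\<bar> * (\<integral>\<^sup>+y. f (Complex x y) \<partial>lborel)" by simp
  qed
  also have "\<dots> = ennreal \<bar>a\<bar> * (\<integral>\<^sup>+x. \<integral>\<^sup>+y. f (Complex x y) \<partial>lborel \<partial>lborel)"
    by (rule nn_integral_cmult) (rule lborel.borel_measurable_nn_integral[OF q(3)])
  also have "(\<integral>\<^sup>+x. \<integral>\<^sup>+y. f (Complex x y) \<partial>lborel \<partial>lborel) = (\<integral>\<^sup>+z. f z \<partial>lborel)"
    by (rule nn_integral_lborel_complex(1)[OF f, symmetric])
  also have "ennreal \<bar>1 / a\<bar> * (ennreal \<bar>a\<bar> * (\<integral>\<^sup>+z. f z \<partial>lborel)) = (\<integral>\<^sup>+z. f z \<partial>lborel)"
  proof -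
    have "ennreal \<bar>1 / a\<bar> * ennreal \<bar>a\<bar> = 1"
      using a by (simp flip: ennreal_mult add: abs_mult[symmetric])
    then show ?thesis by (simp flip: mult.assoc)
  qed
  finally show ?thesis .
qed

lemma lborel_distr_rotate:
  assumes "cmod w = 1" "Re w \<noteq> 0"
  shows "distr lborel borel (\<lambda>z. w * z) = (lborel :: complex measure)"
proof (rule measure_eqI)
  fix A assume "A \<in> sets (distr lborel borel (\<lambda>z. w * z))"
  then have A[measurable]: "A \<in> sets borel" by simp
  have "emeasure (distr lborel borel (\<lambda>z. w * z)) A = (\<integral>\<^sup>+z. indicator A z \<partial>distr lborel borel (\<lambda>z. w * z))"
    by simp
  also have "\<dots> = (\<integral>\<^sup>+z. indicator A (w * z) \<partial>lborel)"
    by (rule nn_integral_distr) auto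
  also have "\<dots> = (\<integral>\<^sup>+z. indicator A z \<partial>lborel)"
    by (rule nn_integral_rotate[OF _ assms]) auto
  finally show "emeasure (distr lborel borel (\<lambda>z. w * z)) A = emeasure lborel A" by simp
qed simp

lemma space_disk_measure [simp]: "space disk_measure = ball 0 1"
  by (simp add: disk_measure_def space_restrict_space)

lemma measurable_disk_measureI:
  "f \<in> borel_measurable borel \<Longrightarrow> f \<in> borel_measurable disk_measure"
  by (simp add: disk_measure_def measurable_restrict_space1)

lemma emeasure_disk_measure:
  assumes [measurable]: "A \<in> sets borel" and sub: "A \<subseteq> ball 0 1"
  shows "emeasure disk_measure A = ennreal (1 / pi) * emeasure lborel A"
proof -
  have "emeasure disk_measure A =
     (\<integral>\<^sup>+(z::complex). ennreal (1 / pi) * indicator A z \<partial>restrict_space lborel (ball 0 1))"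
    unfolding disk_measure_def
    by (subst emeasure_density) (use sub in \<open>auto simp: sets_restrict_space_iff\<close>)
  also have "\<dots> = (\<integral>\<^sup>+(z::complex). ennreal (1 / pi) * indicator A z * indicator (ball 0 1) z \<partial>lborel)"
    by (subst nn_integral_restrict_space) auto
  also have "\<dots> = (\<integral>\<^sup>+z. ennreal (1 / pi) * indicator A z \<partial>lborel)"
    using sub by (intro nn_integral_cong) (auto split: split_indicator)
  also have "\<dots> = ennreal (1 / pi) * emeasure lborel A"
    by (rule nn_integral_cmult_indicator) auto
  finally show ?thesis .
qed

lemma prob_space_disk_measure: "prob_space disk_measure"
  by standard (simp add: emeasure_disk_measure emeasure_ball unit_ball_vol_2 flip: ennreal_mult)

interpretation disk: prob_space disk_measure
  by (rule prob_space_disk_measure)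

text \<open>
  A disk of radius \<open>sqrt x\<close> has normalised area \<open>x\<close>. This replaces polar coordinates.
\<close>

lemma distr_norm_square_disk:
  "distr disk_measure borel (\<lambda>z. (cmod z)\<^sup>2) = uniform_measure lborel {0..1}"
proof (rule cdf_unique)
  have m: "(\<lambda>z. (cmod z)\<^sup>2) \<in> borel_measurable disk_measure"
    by (rule measurable_disk_measureI) measurable
  show 1: "real_distribution (distr disk_measure borel (\<lambda>z. (cmod z)\<^sup>2))"
    by (rule disk.real_distribution_distr[OF m])
  interpret U: prob_space "uniform_measure lborel {0..1::real}"
    by (rule prob_space_uniform_measure) auto
  show "real_distribution (uniform_measure lborel {0..1::real})"
    by unfold_locales auto
  show "cdf (distr disk_measure borel (\<lambda>z. (cmod z)\<^sup>2)) = cdf (uniform_measure lborel {0..1::real})"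
  proof
    fix x :: real
    have L: "cdf (distr disk_measure borel (\<lambda>z. (cmod z)\<^sup>2)) x = measure disk_measure {z \<in> ball 0 1. (cmod z)\<^sup>2 \<le> x}"
      unfolding cdf_def by (subst measure_distr[OF m]) (auto intro!: arg_cong[where f = "measure disk_measure"])
    have R: "cdf (uniform_measure lborel {0..1::real}) x = measure lborel ({0..1} \<inter> {..x})"
      unfolding cdf_def by (subst measure_uniform_measure) auto
    consider "x < 0" | "0 \<le> x" "x < 1" | "1 \<le> x" by linarith
    then show "cdf (distr disk_measure borel (\<lambda>z. (cmod z)\<^sup>2)) x = cdf (uniform_measure lborel {0..1::real}) x"
    proof cases
      case 1
      have "x < (cmod z)\<^sup>2" for z
        using 1 by (rule less_le_trans) simp
      then have e: "{z::complex \<in> ball 0 1. (cmod z)\<^sup>2 \<le> x} = {}" "{0..1} \<inter> {..x} = {}"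
        using 1 by (auto simp: not_le)
      show ?thesis unfolding L R e by simp
    next
      case 2
      have "{z::complex \<in> ball 0 1. (cmod z)\<^sup>2 \<le> x} = cball 0 (sqrt x)"
      proof -
        have "(cmod z)\<^sup>2 \<le> x \<longleftrightarrow> cmod z \<le> sqrt x" for z
          using real_le_rsqrt real_sqrt_le_mono 2 by (metis norm_ge_zero real_sqrt_pow2 power_mono)
        moreover have "cmod z \<le> sqrt x \<Longrightarrow> cmod z < 1" for z
          using 2 by (meson le_less_trans real_sqrt_lt_1_iff)
        ultimately show ?thesis by auto
      qed
      moreover have "sqrt x < 1" using 2 by simp
      then have "cball (0::complex) (sqrt x) \<subseteq> ball 0 1"
        by (intro subsetI) (metis dist_0_norm le_less_trans mem_ball mem_cball)
      then have "measure disk_measure (cball 0 (sqrt x)) = x"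
        using 2 by (simp add: measure_def emeasure_disk_measure emeasure_cball unit_ball_vol_2 flip: ennreal_mult)
      moreover have "{0..1} \<inter> {..x} = {0..x}" using 2 by auto
      ultimately show ?thesis unfolding L R using 2 by simp
    next
      case 3
      have "{z::complex \<in> ball 0 1. (cmod z)\<^sup>2 \<le> x} = space disk_measure"
        using 3 by (auto intro: order_trans[of _ 1] simp: power_le_one)
      moreover have "{0..1} \<inter> {..x} = {0..1}" using 3 by auto
      ultimately show ?thesis unfolding L R using disk.prob_space by simp
    qed
  qed
qed

lemma integral_disk_measure:
  fixes f :: "complex \<Rightarrow> complex"
  assumes "f \<in> borel_measurable borel"
  shows "(LINT z|disk_measure. f z) = (LINT z|lborel. indicator (ball 0 1) z *\<^sub>R ((1 / pi) *\<^sub>R f z))"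
proof -
  have "(LINT z|disk_measure. f z) = (LINT z|restrict_space lborel (ball 0 1). (1 / pi) *\<^sub>R f z)"
    unfolding disk_measure_def
    by (rule integral_density) (use assms in \<open>auto intro: measurable_restrict_space1\<close>)
  also have "\<dots> = (LINT z|lborel. indicator (ball 0 1) z *\<^sub>R ((1 / pi) *\<^sub>R f z))"
    by (subst integral_restrict_space) auto
  finally show ?thesis .
qed

lemma integral_disk_rotate:
  fixes f :: "complex \<Rightarrow> complex"
  assumes [measurable]: "f \<in> borel_measurable borel" and w: "cmod w = 1" "Re w \<noteq> 0"
  shows "(LINT z|disk_measure. f (w * z)) = (LINT z|disk_measure. f z)"
proof -
  have "(LINT z|disk_measure. f (w * z)) = (LINT z|lborel. indicator (ball 0 1) (w * z) *\<^sub>R ((1 / pi) *\<^sub>R f (w * z)))"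
    using w by (subst integral_disk_measure) (auto simp: indicator_def norm_mult)
  also have "\<dots> = (LINT z|distr lborel borel (\<lambda>z. w * z). indicator (ball 0 1) z *\<^sub>R ((1 / pi) *\<^sub>R f z))"
    by (rule integral_distr[symmetric])
      (auto intro!: borel_measurable_scaleR borel_measurable_indicator borel_measurable_const assms(1) simp del: scaleR_scaleR)
  also have "\<dots> = (LINT z|disk_measure. f z)"
    by (simp add: lborel_distr_rotate[OF w] integral_disk_measure)
  finally show ?thesis .
qed

text \<open>
  The diagonal moments are integrals over the uniformly distributed \<open>\<bar>z\<bar>\<^sup>2\<close>. The others vanish because a
  rotation by \<open>w\<close> multiplies the integral by \<open>w\<^sup>n cnj w\<^sup>m\<close>.
\<close>

lemma integral_monomials_ball:
  assumes r: "0 \<le> r" "r \<le> 1"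
  shows "(LINT z|disk_measure. indicator (ball 0 r) z *\<^sub>R (z ^ n * cnj (z ^ m))) =
    (if n = m then of_real ((r\<^sup>2) ^ (n + 1) / (n + 1)) else 0)"
proof (cases "n = m")
  case True
  have pt: "indicator (ball 0 r) z *\<^sub>R (z ^ n * cnj (z ^ n)) = of_real (indicator {..<r\<^sup>2} ((cmod z)\<^sup>2) * ((cmod z)\<^sup>2) ^ n)" for z :: complex
  proof -
    have "cmod z < r \<longleftrightarrow> (cmod z)\<^sup>2 < r\<^sup>2"
      using r by (metis norm_ge_zero power2_less_imp_less power_strict_mono zero_less_numeral)
    then have "indicator (ball 0 r) z = (indicator {..<r\<^sup>2} ((cmod z)\<^sup>2) :: real)"
      by (simp add: indicator_def)
    moreover have "z ^ n * cnj (z ^ n) = of_real (((cmod z)\<^sup>2) ^ n)"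
      by (simp only: complex_norm_square[symmetric] norm_power power_mult[symmetric] mult.commute)
    ultimately show ?thesis by (simp add: scaleR_conv_of_real)
  qed
  have "(LINT z|disk_measure. indicator (ball 0 r) z *\<^sub>R (z ^ n * cnj (z ^ n))) =
     of_real (LINT z|disk_measure. indicator {..<r\<^sup>2} ((cmod z)\<^sup>2) * ((cmod z)\<^sup>2) ^ n)"
    unfolding pt by (rule integral_complex_of_real)
  also have "(LINT z|disk_measure. indicator {..<r\<^sup>2} ((cmod z)\<^sup>2) * ((cmod z)\<^sup>2) ^ n) =
     (LINT t|distr disk_measure borel (\<lambda>z. (cmod z)\<^sup>2). indicator {..<r\<^sup>2} t * t ^ n)"
    by (rule integral_distr[symmetric]) (auto intro!: measurable_disk_measureI)
  also have "\<dots> = (LINT t|lborel. indicator {0..1} t * (indicator {..<r\<^sup>2} t * t ^ n))"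
  proof -
    have "uniform_measure lborel {0..1::real} = density lborel (\<lambda>t. ennreal (indicator {0..1} t))"
      unfolding uniform_measure_def by (intro density_cong) (auto simp: indicator_def divide_ennreal_def)
    then show ?thesis
      unfolding distr_norm_square_disk by (simp add: integral_density)
  qed
  also have "\<dots> = (LINT t|lborel. indicator {0..r\<^sup>2} t *\<^sub>R t ^ n)"
  proof (rule integral_cong_AE)
    have r2: "r\<^sup>2 \<le> 1" using r by (simp add: power_le_one)
    show "AE t in lborel. indicator {0..1} t * (indicator {..<r\<^sup>2} t * t ^ n) = indicator {0..r\<^sup>2} t *\<^sub>R t ^ n"
      using AE_lborel_singleton[of "r\<^sup>2"] by eventually_elim (use r2 in \<open>auto simp: indicator_def\<close>)
  qed auto
  also have "\<dots> = (r\<^sup>2) ^ (n + 1) / (n + 1) - 0 ^ (n + 1) / (n + 1)"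
  proof (rule integral_FTC_Icc)
    fix t :: real
    have "((\<lambda>t. t ^ (n + 1) / (n + 1)) has_real_derivative t ^ n) (at t within {0..r\<^sup>2})"
      using DERIV_cdivide[OF DERIV_pow[of "n + 1" t "{0..r\<^sup>2}"], of "real (n + 1)"] by simp
    then show "((\<lambda>t. t ^ (n + 1) / (n + 1)) has_vector_derivative t ^ n) (at t within {0..r\<^sup>2})"
      by (simp add: has_real_derivative_iff_has_vector_derivative)
  qed (auto intro!: continuous_intros)
  finally show ?thesis using True by simp
next
  case False
  define k where "k = real n - real m"
  have k: "k \<noteq> 0" "\<bar>k\<bar> \<ge> 1" using False unfolding k_def by linarith+
  \<comment> \<open>this angle gives \<open>w\<^sup>n cnj w\<^sup>m = cis 1 \<noteq> 1\<close>, and it is less than \<open>\<pi> / 2\<close>, so \<open>Re w \<noteq> 0\<close>\<close>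
  define w where "w = cis (1 / k)"
  have "\<bar>1 / k\<bar> \<le> 1" using k by (simp add: divide_le_eq_1)
  then have "cos (1 / k) > 0"
    using pi_gt3 by (intro cos_gt_zero_pi) linarith+
  then have w: "cmod w = 1" "Re w \<noteq> 0" by (simp_all add: w_def)
  have "w ^ n * cnj (w ^ m) = cis (real n * (1 / k)) * cis (- (real m * (1 / k)))"
    unfolding w_def Complex.DeMoivre cis_cnj ..
  also have "\<dots> = cis 1"
  proof -
    have "real n * (1 / k) + - (real m * (1 / k)) = (real n - real m) / k"
      by (simp add: diff_divide_distrib)
    then show ?thesis unfolding cis_mult using k(1) by (simp add: k_def)
  qed
  finally have wc: "w ^ n * cnj (w ^ m) = cis 1" .
  let ?I = "LINT z|disk_measure. indicator (ball 0 r) z *\<^sub>R (z ^ n * cnj (z ^ m))"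
  have "?I = (LINT z|disk_measure. indicator (ball 0 r) (w * z) *\<^sub>R ((w * z) ^ n * cnj ((w * z) ^ m)))"
    by (rule integral_disk_rotate[OF _ w, symmetric])
      (intro borel_measurable_scaleR borel_measurable_times borel_measurable_indicator borel_measurable_continuous_onI continuous_intros; simp)
  also have "\<dots> = (LINT z|disk_measure. (w ^ n * cnj (w ^ m)) * (indicator (ball 0 r) z *\<^sub>R (z ^ n * cnj (z ^ m))))"
    using w by (intro Bochner_Integration.integral_cong) (auto simp: indicator_def norm_mult power_mult_distrib)
  also have "\<dots> = cis 1 * ?I"
    unfolding wc by (rule integral_mult_right_zero)
  finally have "(1 - cis 1) * ?I = 0" by (simp add: algebra_simps)
  moreover have "cis 1 \<noteq> 1"
  proof
    assume "cis 1 = 1"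
    then have "sin (1::real) = 0" by (metis cis.sel(2) one_complex.sel(2))
    then show False using sin_gt_zero[of 1] pi_gt3 by simp
  qed
  ultimately show ?thesis using False by simp
qed

section \<open>The Hilbert matrix\<close>

text \<open>
  The summand decreases in \<open>j\<close>, so the row sum dominates a definite integral, by
  \<open>\<integral> dy / (sqrt y (a + y)) = (2 / sqrt a) arctan (sqrt (y / a))\<close>.
\<close>

lemma hilbert_row_lower:
  fixes a :: real
  assumes a: "a > 0"
  shows "(2 / sqrt a) * (arctan (sqrt (real (n + 1) / a)) - arctan (sqrt (1 / a)))
    \<le> (\<Sum>j<n. 1 / (sqrt (real (j + 1)) * (a + real (j + 1))))"
proof -
  define F where "F y = (2 / sqrt a) * arctan (sqrt (y / a))" for y
  have deriv: "(F has_real_derivative 1 / (sqrt y * (a + y))) (at y)" if "y > 0" for y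
  proof -
    define u v where "u = sqrt a" and "v = sqrt y"
    have uv: "u > 0" "v > 0" "a = u * u" "y = v * v" using a that by (simp_all add: u_def v_def)
    have "inverse (1 + (v / u)\<^sup>2) = u * u / (u * u + v * v)"
      using uv by (simp add: field_simps power2_eq_square)
    then have "(2 / u) * (inverse (1 + (v / u)\<^sup>2) * (inverse (v / u) / 2 * (1 / (u * u)))) = 1 / (v * (u * u + v * v))"
      using uv(1,2) by simp
    then have F1: "(2 / u) * (inverse (1 + (v / u)\<^sup>2) * (inverse (v / u) / 2 * (1 / a))) = 1 / (v * (a + y))"
      unfolding uv(3,4) .
    have F2: "sqrt (y / a) = v / u" by (simp add: u_def v_def real_sqrt_divide)
    have eq: "(2 / sqrt a) * (inverse (1 + (sqrt (y / a))\<^sup>2) * (inverse (sqrt (y / a)) / 2 * (1 / a))) = 1 / (sqrt y * (a + y))"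
      unfolding F2 u_def[symmetric] v_def[symmetric] by (rule F1)
    have "(F has_real_derivative (2 / sqrt a) * (inverse (1 + (sqrt (y / a))\<^sup>2) * (inverse (sqrt (y / a)) / 2 * (1 / a)))) (at y)"
      unfolding F_def using a that
      by (intro DERIV_cmult DERIV_chain2[OF DERIV_arctan] DERIV_chain2[OF DERIV_real_sqrt] DERIV_cdivide DERIV_ident) auto
    then show ?thesis unfolding eq .
  qed
  have step: "F (real (j + 2)) - F (real (j + 1)) \<le> 1 / (sqrt (real (j + 1)) * (a + real (j + 1)))" for j
  proof -
    obtain z where z: "real (j + 1) < z" "z < real (j + 2)"
      and eq: "F (real (j + 2)) - F (real (j + 1)) = (real (j + 2) - real (j + 1)) * (1 / (sqrt z * (a + z)))"
      using MVT2[of "real (j + 1)" "real (j + 2)" F "\<lambda>y. 1 / (sqrt y * (a + y))"] deriv by fastforce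
    have "sqrt (real (j + 1)) * (a + real (j + 1)) \<le> sqrt z * (a + z)"
      using z a by (intro mult_mono) auto
    then show ?thesis unfolding eq using a by (simp add: frac_le)
  qed
  have "F (real (n + 1)) - F (real 1) = (\<Sum>j<n. F (real (j + 2)) - F (real (j + 1)))"
    using sum_lessThan_telescope[of "\<lambda>j. F (real (j + 1))" n] by (simp add: add_ac)
  also have "\<dots> \<le> (\<Sum>j<n. 1 / (sqrt (real (j + 1)) * (a + real (j + 1))))"
    by (intro sum_mono step)
  finally show ?thesis by (simp add: F_def algebra_simps)
qed

lemma sum_inverse_sqrt_le: "(\<Sum>i<n. 1 / sqrt (real (i + 1))) \<le> 2 * sqrt (real n)"
proof (induction n)
  case (Suc n)
  have "1 / sqrt (real (n + 1)) \<le> 2 * (sqrt (real (Suc n)) - sqrt (real n))"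
  proof -
    have "(sqrt (real (Suc n)) - sqrt (real n)) * (sqrt (real (Suc n)) + sqrt (real n)) = 1"
      by (simp add: algebra_simps)
    moreover have "sqrt (real (Suc n)) + sqrt (real n) \<le> 2 * sqrt (real (Suc n))" by simp
    moreover have "0 \<le> sqrt (real (Suc n)) - sqrt (real n)" by simp
    ultimately have "1 \<le> (sqrt (real (Suc n)) - sqrt (real n)) * (2 * sqrt (real (Suc n)))"
      by (metis mult_left_mono)
    then show ?thesis by (simp add: field_simps)
  qed
  then show ?case using Suc by simp
qed simp

lemma sum_inverse_pow_three_halves_le: "(\<Sum>i<n. 1 / (real (i + 1) * sqrt (real (i + 1)))) \<le> 3"
proof -
  have "(\<Sum>i<Suc n. 1 / (real (i + 1) * sqrt (real (i + 1)))) \<le> 3 - 2 / sqrt (real (n + 1))" for n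
  proof (induction n)
    case (Suc n)
    define u where "u = sqrt (real (n + 1))"
    define v where "v = sqrt (real (n + 2))"
    have uv: "0 < u" "u \<le> v" "v * v = u * u + 1" "v * v = real (n + 2)" by (simp_all add: u_def v_def)
    have "(v - u) * (v + u) = 1" using uv by (simp add: algebra_simps)
    moreover have "(v - u) * (v + u) \<le> (v - u) * (2 * v)" using uv by (intro mult_left_mono) auto
    ultimately have "1 \<le> 2 * v * (v - u)" by (simp add: mult_ac)
    then have "u \<le> 2 * v * (v - u) * u" using uv by (simp add: mult_le_cancel_right1)
    also have "\<dots> \<le> 2 * v * (v - u) * v" using uv by (intro mult_left_mono) auto
    finally have "u / (u * (v * v * v)) \<le> (2 * v * (v - u) * v) / (u * (v * v * v))"
      using uv by (intro divide_right_mono) auto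
    also have "(2 * v * (v - u) * v) / (u * (v * v * v)) = 2 * (v - u) / (u * v)"
      using uv(1,2) by simp
    also have "\<dots> = 2 / u - 2 / v" using uv(1,2) by (simp add: diff_divide_distrib right_diff_distrib)
    finally have "1 / (v * v * v) \<le> 2 / u - 2 / v"
      using uv(1) by simp
    moreover have "1 / (real (n + 2) * sqrt (real (n + 2))) = 1 / (v * v * v)" using uv(4) by (simp add: v_def)
    ultimately show ?case using Suc by (simp add: u_def v_def add_ac)
  qed simp
  note * = this
  show ?thesis
  proof (cases n)
    case (Suc m)
    then show ?thesis using *[of m] by (smt (verit) divide_nonneg_nonneg of_nat_0_le_iff real_sqrt_ge_zero)
  qed simp
qed

text \<open>
  The quadratic form of the Hilbert matrix at \<open>x\<^sub>i = 1 / sqrt (i + 1)\<close>, where \<open>\<parallel>x\<parallel>\<^sup>2\<close> is the harmonic number,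
  falls short of \<open>\<pi> \<parallel>x\<parallel>\<^sup>2\<close> by a bounded amount only. In row \<open>i\<close> the loss comes from the two ends of the
  range of the arctangent; the upper end costs \<open>O(1 / sqrt (n i))\<close> and the lower end \<open>O(i powr (-3/2))\<close>,
  and both are bounded when summed over \<open>i\<close>.
\<close>

lemma hilbert_form_lower:
  "pi * harm n - 10 \<le>
    (\<Sum>i<n. \<Sum>j<n. 1 / (sqrt (real (i + 1)) * sqrt (real (j + 1)) * real (i + j + 1)))"
proof (cases "n = 0")
  case False
  have row: "pi * (1 / real (i + 1)) - 2 / sqrt (real n) * (1 / sqrt (real (i + 1))) - 2 * (1 / (real (i + 1) * sqrt (real (i + 1))))
     \<le> (\<Sum>j<n. 1 / (sqrt (real (i + 1)) * sqrt (real (j + 1)) * real (i + j + 1)))" if "i < n" for i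
  proof -
    define a where "a = real (i + 1)"
    have a: "a > 0" by (simp add: a_def)
    have ss: "sqrt a * sqrt a = a" using a by simp
    have nn: "real n > 0" using False by simp
    have A1: "arctan (sqrt (1 / a)) \<le> 1 / sqrt a"
      using arctan_le_self[of "sqrt (1 / a)"] a by (simp add: real_sqrt_divide)
    have "pi / 2 - sqrt a / sqrt (real n) \<le> arctan (sqrt (real n / a))"
    proof -
      define x where "x = sqrt (real n / a)"
      have x: "x > 0" using a nn by (simp add: x_def)
      have "arctan (1 / x) = pi / 2 - arctan x"
        using arctan_inverse[of x] x by (simp add: inverse_eq_divide)
      moreover have "arctan (1 / x) \<le> 1 / x" using x by (intro arctan_le_self) auto
      moreover have "1 / x = sqrt a / sqrt (real n)" by (simp add: x_def real_sqrt_divide)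
      ultimately show ?thesis by (simp add: x_def)
    qed
    also have "\<dots> \<le> arctan (sqrt (real (n + 1) / a))"
      using a by (intro arctan_monotone' real_sqrt_le_mono divide_right_mono) auto
    finally have "pi / 2 - sqrt a / sqrt (real n) - 1 / sqrt a \<le> arctan (sqrt (real (n + 1) / a)) - arctan (sqrt (1 / a))"
      using A1 by linarith
    then have "(2 / a) * (pi / 2 - sqrt a / sqrt (real n) - 1 / sqrt a)
       \<le> (2 / a) * (arctan (sqrt (real (n + 1) / a)) - arctan (sqrt (1 / a)))"
      using a by (intro mult_left_mono) auto
    also have "\<dots> = (1 / sqrt a) * ((2 / sqrt a) * (arctan (sqrt (real (n + 1) / a)) - arctan (sqrt (1 / a))))"
      using ss by (simp add: field_simps)
    also have "\<dots> \<le> (1 / sqrt a) * (\<Sum>j<n. 1 / (sqrt (real (j + 1)) * (a + real (j + 1))))"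
      using a by (intro mult_left_mono hilbert_row_lower) auto
    also have "\<dots> = (\<Sum>j<n. 1 / (sqrt a * sqrt (real (j + 1)) * (a + real (j + 1))))"
      by (simp add: sum_distrib_left mult_ac)
    also have "\<dots> \<le> (\<Sum>j<n. 1 / (sqrt a * sqrt (real (j + 1)) * real (i + j + 1)))"
      using a by (intro sum_mono divide_left_mono mult_left_mono mult_pos_pos) (auto simp: a_def)
    finally have "(2 / a) * (pi / 2 - sqrt a / sqrt (real n) - 1 / sqrt a) \<le>
       (\<Sum>j<n. 1 / (sqrt a * sqrt (real (j + 1)) * real (i + j + 1)))" .
    moreover have "(2 / a) * (pi / 2 - sqrt a / sqrt (real n) - 1 / sqrt a)
       = pi * (1 / a) - 2 / sqrt (real n) * (1 / sqrt a) - 2 * (1 / (a * sqrt a))"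
    proof -
      have "sqrt a / a = 1 / sqrt a" using ss a by (simp add: divide_simps)
      then have "(2 / a) * (sqrt a / sqrt (real n)) = 2 / sqrt (real n) * (1 / sqrt a)"
        by (metis (no_types, opaque_lifting) times_divide_eq_left times_divide_eq_right mult.commute)
      then show ?thesis by (simp add: right_diff_distrib)
    qed
    ultimately show ?thesis by (simp add: a_def)
  qed
  have "pi * (\<Sum>i<n. 1 / real (i + 1)) - 2 / sqrt (real n) * (\<Sum>i<n. 1 / sqrt (real (i + 1)))
       - 2 * (\<Sum>i<n. 1 / (real (i + 1) * sqrt (real (i + 1))))
     = (\<Sum>i<n. pi * (1 / real (i + 1)) - 2 / sqrt (real n) * (1 / sqrt (real (i + 1))) - 2 * (1 / (real (i + 1) * sqrt (real (i + 1)))))"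
    by (simp only: sum_subtractf sum_distrib_left)
  also have "\<dots> \<le> (\<Sum>i<n. \<Sum>j<n. 1 / (sqrt (real (i + 1)) * sqrt (real (j + 1)) * real (i + j + 1)))"
    by (intro sum_mono row) auto
  finally have main: "pi * (\<Sum>i<n. 1 / real (i + 1)) - 2 / sqrt (real n) * (\<Sum>i<n. 1 / sqrt (real (i + 1)))
       - 2 * (\<Sum>i<n. 1 / (real (i + 1) * sqrt (real (i + 1)))) \<le> (\<Sum>i<n. \<Sum>j<n. 1 / (sqrt (real (i + 1)) * sqrt (real (j + 1)) * real (i + j + 1)))" .
  have "2 / sqrt (real n) * (\<Sum>i<n. 1 / sqrt (real (i + 1))) \<le> 2 / sqrt (real n) * (2 * sqrt (real n))"
    by (intro mult_left_mono sum_inverse_sqrt_le) auto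
  also have "\<dots> = 4" using False by simp
  moreover have "(harm n :: real) = (\<Sum>i<n. 1 / real (i + 1))" by (simp add: harm_altdef inverse_eq_divide)
  ultimately show ?thesis using main sum_inverse_pow_three_halves_le[of n] by simp
qed (simp add: harm_altdef)

text \<open>
  The harmonic numbers are unbounded, so the bounded defect is absorbed by any loss in the constant.
\<close>

lemma hilbert_form_near_pi:
  assumes "c < pi"
  obtains n where "n > 0" "c * harm n \<le>
    (\<Sum>i<n. \<Sum>j<n. 1 / (sqrt (real (i + 1)) * sqrt (real (j + 1)) * real (i + j + 1)))"
proof -
  have "eventually (\<lambda>n. 10 / (pi - c) \<le> (harm n :: real)) sequentially"
    using harm_at_top by (auto simp: filterlim_at_top)
  then have "eventually (\<lambda>n. n > 0 \<and> 10 / (pi - c) \<le> (harm n :: real)) sequentially"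
    by (intro eventually_conj eventually_gt_at_top)
  then obtain n :: nat where n: "n > 0" "10 / (pi - c) \<le> (harm n :: real)"
    using eventually_happens'[OF sequentially_bot] by blast
  then have "10 \<le> (pi - c) * harm n"
    using assms by (simp add: field_simps)
  then show thesis
    using that[OF n(1)] hilbert_form_lower[of n] by (simp add: algebra_simps)
qed

section \<open>Gram matrices and operator Hilbert space\<close>

lemma borel_measurable_cnj [measurable (raw)]:
  "f \<in> borel_measurable M \<Longrightarrow> (\<lambda>x. cnj (f x)) \<in> borel_measurable M"
  by (rule measurable_compose[of f M borel]) (auto intro!: borel_measurable_continuous_onI continuous_intros)

lemma square_integrable_0: "(\<lambda>_. 0) \<in> square_integrable M"
  by (simp add: square_integrable_def)

lemma square_integrable_scale:
  assumes "f \<in> square_integrable M"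
  shows "(\<lambda>z. c * f z) \<in> square_integrable M"
  using assms by (auto simp: square_integrable_def norm_mult power_mult_distrib)

lemma square_integrable_add:
  assumes "f \<in> square_integrable M" "g \<in> square_integrable M"
  shows "(\<lambda>z. f z + g z) \<in> square_integrable M"
proof -
  have [measurable]: "f \<in> borel_measurable M" "g \<in> borel_measurable M"
    using assms by (auto simp: square_integrable_def)
  have "integrable M (\<lambda>z. (cmod (f z + g z))\<^sup>2)"
  proof (rule Bochner_Integration.integrable_bound)
    show "integrable M (\<lambda>z. 2 * (cmod (f z))\<^sup>2 + 2 * (cmod (g z))\<^sup>2)"
      using assms by (auto simp: square_integrable_def)
    have "(cmod (f z + g z))\<^sup>2 \<le> 2 * (cmod (f z))\<^sup>2 + 2 * (cmod (g z))\<^sup>2" for z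
    proof -
      have "(cmod (f z + g z))\<^sup>2 \<le> (cmod (f z) + cmod (g z))\<^sup>2"
        by (intro power_mono norm_triangle_ineq) simp
      also have "\<dots> \<le> 2 * (cmod (f z))\<^sup>2 + 2 * (cmod (g z))\<^sup>2"
        using sum_squares_bound[of "cmod (f z)" "cmod (g z)"] by (simp add: power2_sum)
      finally show ?thesis .
    qed
    then show "AE z in M. norm ((cmod (f z + g z))\<^sup>2) \<le> norm (2 * (cmod (f z))\<^sup>2 + 2 * (cmod (g z))\<^sup>2)"
      by simp
  qed measurable
  then show ?thesis by (simp add: square_integrable_def)
qed

lemma square_integrable_sum:
  assumes "\<And>k. k \<in> K \<Longrightarrow> f k \<in> square_integrable M"
  shows "(\<lambda>z. \<Sum>k\<in>K. f k z) \<in> square_integrable M"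
  using assms
  by (induction K rule: infinite_finite_induct) (auto intro: square_integrable_0 square_integrable_add)

lemma integral_norm_square_eq_0:
  assumes "g \<in> square_integrable M" "(LINT z|M. (cmod (g z))\<^sup>2) = 0"
  shows "AE z in M. g z = 0"
proof -
  have "AE z in M. (cmod (g z))\<^sup>2 = 0"
    using assms by (subst (asm) integral_nonneg_eq_0_iff_AE) (auto simp: square_integrable_def)
  then show ?thesis by simp
qed

lemma integral_mult_cnj_self: "(LINT z|M. g z * cnj (g z)) = complex_of_real (LINT z|M. (cmod (g z))\<^sup>2)"
  by (simp only: complex_norm_square[symmetric] integral_complex_of_real)

text \<open>
  Gram-Schmidt for functions that are not identified modulo null sets: a new vector whose component
  orthogonal to the previous ones has norm zero is dropped.
\<close>

lemma gram_schmidt: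
  fixes N :: nat
  assumes "\<And>k. k < N \<Longrightarrow> f k \<in> square_integrable M"
  shows "\<exists>d v c. orthonormal_family M d v \<and> (\<forall>k<N. AE z in M. f k z = (\<Sum>l<d. c k l * v l z))"
  using assms
proof (induction N)
  case 0
  show ?case by (intro exI[of _ 0]) (simp add: orthonormal_family_def)
next
  case (Suc N)
  have "\<exists>d v c. orthonormal_family M d v \<and> (\<forall>k<N. AE z in M. f k z = (\<Sum>l<d. c k l * v l z))"
    using Suc by simp
  then obtain d v c where v: "orthonormal_family M d v"
    and c: "\<And>k. k < N \<Longrightarrow> AE z in M. f k z = (\<Sum>l<d. c k l * v l z)"
    by blast
  have vsq: "v l \<in> square_integrable M" if "l < d" for l
    using v that by (auto simp: orthonormal_family_def)
  have von: "(LINT z|M. v k z * cnj (v l z)) = (if k = l then 1 else 0)" if "k < d" "l < d" for k l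
    using v that by (auto simp: orthonormal_family_def)
  have fN: "f N \<in> square_integrable M" using Suc.prems by simp
  define \<alpha> where "\<alpha> l = (LINT z|M. f N z * cnj (v l z))" for l
  define g where "g z = f N z + (\<Sum>l<d. (- \<alpha> l) * v l z)" for z
  have gsq: "g \<in> square_integrable M"
    unfolding g_def by (intro square_integrable_add fN square_integrable_sum square_integrable_scale vsq) auto
  have fNg: "f N z = g z + (\<Sum>l<d. \<alpha> l * v l z)" for z
    by (simp add: g_def sum_negf)
  have orth: "(LINT z|M. g z * cnj (v l z)) = 0" if l: "l < d" for l
  proof -
    have "(LINT z|M. g z * cnj (v l z)) =
        (LINT z|M. f N z * cnj (v l z) + (\<Sum>k<d. (- \<alpha> k) * (v k z * cnj (v l z))))"
      by (simp add: g_def algebra_simps sum_distrib_left sum_distrib_right)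
    also have "\<dots> = \<alpha> l + (\<Sum>k<d. (- \<alpha> k) * (LINT z|M. v k z * cnj (v l z)))"
    proof -
      have i: "integrable M (\<lambda>z. (- \<alpha> k) * (v k z * cnj (v l z)))" if "k < d" for k
        by (intro integrable_mult_right square_integrable_mult_cnj vsq that l)
      have "(LINT z|M. (\<Sum>k<d. (- \<alpha> k) * (v k z * cnj (v l z)))) =
          (\<Sum>k<d. LINT z|M. (- \<alpha> k) * (v k z * cnj (v l z)))"
        by (rule Bochner_Integration.integral_sum) (rule i, simp)
      also have "\<dots> = (\<Sum>k<d. (- \<alpha> k) * (LINT z|M. v k z * cnj (v l z)))"
        by (intro sum.cong refl integral_mult_right_zero)
      finally have "(LINT z|M. (\<Sum>k<d. (- \<alpha> k) * (v k z * cnj (v l z)))) =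
          (\<Sum>k<d. (- \<alpha> k) * (LINT z|M. v k z * cnj (v l z)))" .
      moreover have "integrable M (\<lambda>z. \<Sum>k<d. (- \<alpha> k) * (v k z * cnj (v l z)))"
        by (rule Bochner_Integration.integrable_sum) (rule i, simp)
      moreover have "integrable M (\<lambda>z. f N z * cnj (v l z))"
        by (intro square_integrable_mult_cnj fN vsq l)
      ultimately show ?thesis by (simp add: \<alpha>_def)
    qed
    also have "(\<Sum>k<d. (- \<alpha> k) * (LINT z|M. v k z * cnj (v l z))) = (\<Sum>k<d. if k = l then - \<alpha> k else 0)"
      using l by (intro sum.cong refl) (auto simp: von)
    also have "\<dots> = - \<alpha> l" using l by simp
    finally show ?thesis by simp
  qed
  have orth': "(LINT z|M. v l z * cnj (g z)) = 0" if l: "l < d" for l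
  proof -
    have "(LINT z|M. v l z * cnj (g z)) = (LINT z|M. cnj (g z * cnj (v l z)))"
      by (simp add: mult.commute)
    also have "\<dots> = cnj (LINT z|M. g z * cnj (v l z))"
      by (rule Bochner_Integration.integral_cnj)
    finally show ?thesis using orth[OF l] by simp
  qed
  define s where "s = (LINT z|M. (cmod (g z))\<^sup>2)"
  have s0: "s \<ge> 0" unfolding s_def by simp
  show ?case
  proof (cases "s = 0")
    case True
    then have "AE z in M. g z = 0"
      using integral_norm_square_eq_0[OF gsq] by (simp add: s_def)
    then have "AE z in M. f N z = (\<Sum>l<d. \<alpha> l * v l z)"
      by eventually_elim (simp add: fNg)
    then show ?thesis
      using v c
      by (intro exI[of _ d] exI[of _ v] exI[of _ "\<lambda>k. if k = N then \<alpha> else c k"]) (auto simp: less_Suc_eq)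
  next
    case False
    define t where "t = complex_of_real (sqrt s)"
    have t: "t \<noteq> 0" "t * t = of_real s" "cnj t = t"
      using False s0 by (simp_all add: t_def flip: of_real_mult)
    define w where "w = v(d := (\<lambda>z. inverse t * g z))"
    define c' where "c' k l = (if k = N then (if l < d then \<alpha> l else t) else (if l < d then c k l else 0))" for k l
    have wl: "w l = v l" if "l < d" for l using that by (simp add: w_def)
    have wd: "w d = (\<lambda>z. inverse t * g z)" by (simp add: w_def)
    have "orthonormal_family M (Suc d) w"
      unfolding orthonormal_family_def
    proof (intro conjI allI impI)
      fix k assume "k < Suc d"
      then show "w k \<in> square_integrable M"
        by (cases "k = d") (auto simp: wd wl intro: square_integrable_scale gsq vsq)
    next
      fix k l assume kl: "k < Suc d" "l < Suc d"
      consider "k < d" "l < d" | "k = d" "l < d" | "k < d" "l = d" | "k = d" "l = d"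
        using kl by linarith
      then show "(LINT z|M. w k z * cnj (w l z)) = (if k = l then 1 else 0)"
      proof cases
        case 1
        then show ?thesis by (simp add: wl von)
      next
        case 2
        have "(LINT z|M. w k z * cnj (w l z)) = (LINT z|M. inverse t * (g z * cnj (v l z)))"
          using 2 by (simp add: wl wd mult.assoc)
        also have "\<dots> = inverse t * (LINT z|M. g z * cnj (v l z))" by (rule integral_mult_right_zero)
        finally show ?thesis using 2 orth by simp
      next
        case 3
        have "(LINT z|M. w k z * cnj (w l z)) = (LINT z|M. inverse t * (v k z * cnj (g z)))"
          using 3 t by (simp add: wl wd mult_ac)
        also have "\<dots> = inverse t * (LINT z|M. v k z * cnj (g z))" by (rule integral_mult_right_zero)
        finally show ?thesis using 3 orth' by simp
      next
        case 4
        have "(LINT z|M. w k z * cnj (w l z)) = (LINT z|M. (inverse t * inverse t) * (g z * cnj (g z)))"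
          using 4 t by (simp add: wd mult_ac)
        also have "\<dots> = (inverse t * inverse t) * (LINT z|M. g z * cnj (g z))" by (rule integral_mult_right_zero)
        also have "\<dots> = (inverse t * inverse t) * (t * t)"
          unfolding integral_mult_cnj_self t(2) s_def ..
        also have "\<dots> = 1" using t(1) by (simp add: divide_simps)
        finally show ?thesis using 4 by simp
      qed
    qed
    moreover have "AE z in M. f k z = (\<Sum>l<Suc d. c' k l * w l z)" if k: "k < Suc N" for k
    proof (cases "k = N")
      case True
      have "f k z = (\<Sum>l<Suc d. c' k l * w l z)" for z
        using t True by (simp add: fNg c'_def wl wd add.commute)
      then show ?thesis by simp
    next
      case False
      with k have "k < N" by simp
      from c[OF this] show ?thesis
        by eventually_elim (use False in \<open>simp add: c'_def wl\<close>)
    qed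
    ultimately show ?thesis by blast
  qed
qed

text \<open>
  The coefficients of an orthonormal expansion enter the \<open>OH\<close> norm only through the inner products of
  the entries.
\<close>

lemma OH_matrix_norm_eq_gram:
  assumes h: "\<And>i j. i < n \<Longrightarrow> j < n \<Longrightarrow> h i j \<in> square_integrable M"
  shows "OH_matrix_norm M n h = ennreal (sqrt (matrix_op_norm ({..<n} \<times> {..<n})
           (\<lambda>(i, p) (j, q). LINT z|M. h i j z * cnj (h p q z))))"
proof -
  have "\<exists>d v c. orthonormal_family M d v \<and>
      (\<forall>k<n * n. AE z in M. h (k div n) (k mod n) z = (\<Sum>l<d. c k l * v l z))"
    by (rule gram_schmidt, rule h)
       (auto simp: less_mult_imp_div_less intro!: mod_less_divisor gr0I)
  then obtain d v c where v: "orthonormal_family M d v"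
    and c: "\<And>k. k < n * n \<Longrightarrow> AE z in M. h (k div n) (k mod n) z = (\<Sum>l<d. c k l * v l z)"
    by blast
  \<comment> \<open>the entries are enumerated row by row, as \<open>gram_schmidt\<close> takes a sequence\<close>
  define a where "a l i j = c (i * n + j) l" for l i j
  have exp: "orthonormal_expansion M n h d v a"
    unfolding orthonormal_expansion_def
  proof (intro conjI allI impI v)
    fix i j assume ij: "i < n" "j < n"
    show "h i j \<in> borel_measurable M" using h[OF ij] by (simp add: square_integrable_def)
    have "i * n + j < (i + 1) * n" using ij by simp
    also have "\<dots> \<le> n * n" using ij by (intro mult_right_mono) auto
    finally show "AE z in M. h i j z = (\<Sum>k<d. a k i j * v k z)"
      using c[of "i * n + j"] ij by (simp add: a_def)
  qed
  have "conj_tensor_norm n d a = matrix_op_norm ({..<n} \<times> {..<n})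
           (\<lambda>(i, p) (j, q). LINT z|M. h i j z * cnj (h p q z))"
    unfolding conj_tensor_norm_def
    by (rule matrix_op_norm_cong) (auto simp: orthonormal_expansion_gram[OF exp])
  then show ?thesis by (simp add: OH_matrix_norm_expansion[OF exp])
qed

section \<open>A bounded symbol of the Hilbert matrix\<close>

text \<open>
  On the circle this is the complex conjugate of \<open>\<Sum>\<^sub>k \<rho>\<^sup>k\<^sup>+\<^sup>1 / (k + 1) (x\<^sup>k - cnj x\<^sup>k\<^sup>+\<^sup>2)\<close>, the smoothed symbol \<open>\<psi>\<close>.
  The closed form comes from \<open>Ln (1 - \<rho> x) = - \<Sum>\<^sub>k \<rho>\<^sup>k x\<^sup>k / k\<close>: the logarithm minus its conjugate is
  the smoothed sawtooth, and the factor \<open>x\<close> shifts the frequencies.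
\<close>

definition hilbert_kernel :: "real \<Rightarrow> complex \<Rightarrow> complex" where
  "hilbert_kernel \<rho> x = 2 * \<i> * of_real (Im (Ln (1 - of_real \<rho> * x))) * x"

lemma Re_one_minus_pos:
  assumes "0 \<le> \<rho>" "\<rho> < 1" "cmod x = 1"
  shows "Re (1 - of_real \<rho> * x) > 0"
proof -
  have "Re (of_real \<rho> * x) \<le> cmod (of_real \<rho> * x)" by (rule complex_Re_le_cmod)
  then show ?thesis using assms by (simp add: norm_mult)
qed

text \<open>
  The number \<open>1 - \<rho> x\<close> lies in the right half-plane, so its argument is at most \<open>\<pi> / 2\<close>. This is the source
  of the constant \<open>\<pi>\<close>.
\<close>

lemma cmod_hilbert_kernel_le_pi:
  assumes "0 \<le> \<rho>" "\<rho> < 1" "cmod x = 1"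
  shows "cmod (hilbert_kernel \<rho> x) \<le> pi"
proof -
  have "Re (1 - of_real \<rho> * x) > 0" by (rule Re_one_minus_pos[OF assms])
  then have "\<bar>Im (Ln (1 - of_real \<rho> * x))\<bar> < pi / 2"
    using Re_Ln_pos_lt_imp Re_Ln_pos_lt by (metis less_numeral_extra(3) zero_complex.sel(1))
  then show ?thesis using assms by (simp add: hilbert_kernel_def norm_mult)
qed

lemma hilbert_kernel_sums:
  assumes "0 \<le> \<rho>" "\<rho> < 1" "cmod x = 1"
  shows "(\<lambda>k. of_real (\<rho> ^ (k + 1) / (k + 1)) * (x powi (- int k) - x ^ (k + 2))) sums hilbert_kernel \<rho> x"
proof -
  have xc: "cnj x * x = 1" using assms(3) by (metis complex_norm_square mult.commute of_real_1 power_one)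
  have x0: "x \<noteq> 0" using assms(3) by auto
  have inv: "inverse x = cnj x" using xc x0 by (metis inverse_unique mult.commute)
  define w where "w = of_real \<rho> * x"
  have w: "cmod w < 1" using assms by (simp add: w_def norm_mult)
  have "(\<lambda>n. - ((- (- w)) ^ n) / of_nat n) sums Ln (1 + (- w))"
    by (rule Ln_series') (use w in simp)
  then have "(\<lambda>n. - (w ^ n) / of_nat n) sums Ln (1 - w)" by simp
  then have S: "(\<lambda>k. - (w ^ Suc k) / of_nat (Suc k)) sums Ln (1 - w)"
    by (subst sums_Suc_iff) simp
  then have "(\<lambda>k. cnj (- (w ^ Suc k) / of_nat (Suc k))) sums cnj (Ln (1 - w))"
    by (subst sums_cnj)
  then have "(\<lambda>k. (- (w ^ Suc k) / of_nat (Suc k) - cnj (- (w ^ Suc k) / of_nat (Suc k))) * x) sums ((Ln (1 - w) - cnj (Ln (1 - w))) * x)"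
    by (intro sums_mult2 sums_diff S)
  also have "(Ln (1 - w) - cnj (Ln (1 - w))) * x = hilbert_kernel \<rho> x"
    by (simp add: hilbert_kernel_def w_def complex_diff_cnj)
  also have "(\<lambda>k. (- (w ^ Suc k) / of_nat (Suc k) - cnj (- (w ^ Suc k) / of_nat (Suc k))) * x)
     = (\<lambda>k. of_real (\<rho> ^ (k + 1) / (k + 1)) * (x powi (- int k) - x ^ (k + 2)))"
  proof
    fix k
    have "x powi (- int k) = cnj x ^ k"
      by (simp add: power_int_minus inv flip: power_inverse)
    moreover have "cnj x ^ Suc k * x = cnj x ^ k" using xc by (simp add: mult.assoc mult.left_commute)
    ultimately have eq: "x powi (- int k) - x ^ (k + 2) = (cnj x ^ Suc k - x ^ Suc k) * x"
      by (simp add: algebra_simps)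
    have "(- (R * p) / N - (- (R * q) / N)) * x = R / N * ((q - p) * x)" for R N p q :: complex
      by (simp add: diff_divide_distrib algebra_simps)
    from this[of "of_real \<rho> ^ Suc k" "x ^ Suc k" "of_nat (Suc k)" "cnj x ^ Suc k"]
    show "(- (w ^ Suc k) / of_nat (Suc k) - cnj (- (w ^ Suc k) / of_nat (Suc k))) * x
      = of_real (\<rho> ^ (k + 1) / (k + 1)) * (x powi (- int k) - x ^ (k + 2))"
      unfolding eq w_def by (simp add: power_mult_distrib del: of_nat_Suc power_Suc)
  qed
  finally show ?thesis .
qed

lemma continuous_on_hilbert_kernel:
  assumes "0 \<le> \<rho>" "\<rho> < 1" "cmod s = 1"
  shows "continuous_on (sphere 0 1) (\<lambda>t. hilbert_kernel \<rho> (t / s))"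
proof -
  have "1 - of_real \<rho> * (t / s) \<notin> \<real>\<^sub>\<le>\<^sub>0" if "t \<in> sphere 0 1" for t
    using Re_one_minus_pos[OF assms(1,2), of "t / s"] that assms(3)
    by (auto simp: complex_nonpos_Reals_iff norm_divide)
  moreover have "s \<noteq> 0" using assms by auto
  ultimately show ?thesis
    unfolding hilbert_kernel_def by (intro continuous_intros) auto
qed

lemma integral_mult_sums:
  fixes f :: "'a \<Rightarrow> complex"
  assumes f: "integrable M f" and u: "\<And>k. u k \<in> borel_measurable M"
    and le: "\<And>k x. x \<in> space M \<Longrightarrow> cmod (u k x) \<le> b k" and b: "summable b"
    and s: "\<And>x. x \<in> space M \<Longrightarrow> (\<lambda>k. u k x) sums U x"
  shows "(\<lambda>k. LINT x|M. f x * u k x) sums (LINT x|M. f x * U x)"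
proof (cases "space M = {}")
  case True
  then have "(LINT x|M. g x) = (LINT x|M. 0)" for g :: "'a \<Rightarrow> complex"
    by (intro Bochner_Integration.integral_cong) auto
  then show ?thesis by simp
next
  case False
  then have b0: "b k \<ge> 0" for k using le norm_ge_zero order_trans by (metis ex_in_conv)
  have i: "integrable M (\<lambda>x. f x * u k x)" for k
  proof (rule Bochner_Integration.integrable_bound)
    show "integrable M (\<lambda>x. b k * norm (f x))" using f by auto
    show "AE x in M. norm (f x * u k x) \<le> norm (b k * norm (f x))"
      using le[of _ k] b0[of k]
      by (intro AE_I2) (simp add: norm_mult mult.commute[of "b k"] mult_left_mono)
  qed (use f u in measurable)
  have "(\<lambda>k. LINT x|M. f x * u k x) sums (LINT x|M. (\<Sum>k. f x * u k x))"
  proof (rule sums_integral[OF i])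
    show "AE x in M. summable (\<lambda>k. norm (f x * u k x))"
    proof (rule AE_I2)
      fix x assume x: "x \<in> space M"
      show "summable (\<lambda>k. norm (f x * u k x))"
        by (rule summable_comparison_test'[OF summable_mult[OF b, of "norm (f x)"], of 0])
           (simp add: norm_mult mult_left_mono le[OF x])
    qed
    have "norm (LINT x|M. norm (f x * u k x)) \<le> (LINT x|M. norm (f x)) * b k" for k
    proof -
      have "(LINT x|M. norm (f x * u k x)) \<le> (LINT x|M. norm (f x) * b k)"
        using integrable_norm[OF i] f le by (intro integral_mono) (auto simp: norm_mult mult_left_mono)
      then show ?thesis by simp
    qed
    then show "summable (\<lambda>k. LINT x|M. norm (f x * u k x))"
      by (intro summable_comparison_test'[OF summable_mult[OF b], of 0]) auto
  qed
  also have "(LINT x|M. (\<Sum>k. f x * u k x)) = (LINT x|M. f x * U x)"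
    by (intro Bochner_Integration.integral_cong refl sums_unique[symmetric] sums_mult s)
  finally show ?thesis .
qed

lemma Hardy1_integrable: "f \<in> Hardy1 \<Longrightarrow> integrable circle_measure f"
  by (simp add: Hardy1_def)

lemma kernel_coeff_le:
  assumes "0 \<le> \<rho>" "\<rho> \<le> 1"
  shows "\<rho> ^ (k + 1) / real (k + 1) \<le> \<rho> ^ k"
proof -
  have "\<rho> ^ (k + 1) / real (k + 1) \<le> \<rho> ^ (k + 1) / 1"
    using assms by (intro divide_left_mono) auto
  also have "\<dots> \<le> \<rho> ^ k" using assms by (simp add: mult_left_le_one_le)
  finally show ?thesis .
qed

lemma summable_kernel_coeffs:
  assumes "0 \<le> \<rho>" "\<rho> < 1"
  shows "summable (\<lambda>k. C * (\<rho> ^ (k + 1) / real (k + 1)))"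
proof (rule summable_mult, rule summable_comparison_test')
  show "summable (\<lambda>k. \<rho> ^ k)" using assms by (intro summable_geometric) simp
  fix k :: nat
  have "\<rho> ^ (k + 1) / real (k + 1) \<le> \<rho> ^ k" using assms by (intro kernel_coeff_le) auto
  then show "norm (\<rho> ^ (k + 1) / real (k + 1)) \<le> \<rho> ^ k" using assms by simp
qed

definition hilbert_convolution :: "real \<Rightarrow> (complex \<Rightarrow> complex) \<Rightarrow> complex \<Rightarrow> complex" where
  "hilbert_convolution \<rho> f s = (LINT t|circle_measure. f t * hilbert_kernel \<rho> (t / s))"

text \<open>
  The terms \<open>x\<^sup>k\<^sup>+\<^sup>2\<close> of the kernel pair \<open>f\<close> with \<open>t\<^sup>k\<^sup>+\<^sup>2\<close>, that is, they produce negative Fourier coefficients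
  of \<open>f\<close>; these vanish on \<open>H\<^sup>1\<close>, and only the weights of the Hilbert matrix remain.
\<close>

lemma hilbert_convolution_sums:
  assumes f: "f \<in> Hardy1" and \<rho>: "0 \<le> \<rho>" "\<rho> < 1" and s: "cmod s = 1"
  shows "(\<lambda>k. of_real (\<rho> ^ (k + 1) / (k + 1)) * fourier_coeff f (int k) * s ^ k) sums hilbert_convolution \<rho> f s"
proof -
  have s0: "s \<noteq> 0" using s by auto
  define u where "u k t = of_real (\<rho> ^ (k + 1) / (k + 1)) * ((t / s) powi (- int k) - (t / s) ^ (k + 2))" for k :: nat and t
  have "(\<lambda>k. LINT t|circle_measure. f t * u k t) sums hilbert_convolution \<rho> f s"
    unfolding hilbert_convolution_def
  proof (rule integral_mult_sums)
    show "integrable circle_measure f" using f by (rule Hardy1_integrable)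
    show "u k \<in> borel_measurable circle_measure" for k
      unfolding u_def using s0
      by (intro continuous_on_sphere_imp_measurable continuous_intros) auto
    show "summable (\<lambda>k. 2 * (\<rho> ^ (k + 1) / real (k + 1)))"
      by (rule summable_kernel_coeffs[OF \<rho>])
    fix t assume "t \<in> space circle_measure"
    then have t: "cmod (t / s) = 1" using s by (simp add: norm_divide)
    show "(\<lambda>k. u k t) sums hilbert_kernel \<rho> (t / s)"
      unfolding u_def by (rule hilbert_kernel_sums[OF \<rho> t])
    show "cmod (u k t) \<le> 2 * (\<rho> ^ (k + 1) / real (k + 1))" for k
    proof -
      have "cmod ((t / s) powi (- int k) - (t / s) ^ (k + 2)) \<le> 1 + 1"
        by (rule order_trans[OF norm_triangle_ineq4]) (simp only: norm_power_int norm_power t, simp)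
      moreover have "cmod (of_real (\<rho> ^ (k + 1) / (k + 1))) = \<rho> ^ (k + 1) / real (k + 1)"
        using \<rho> by (subst norm_of_real) simp
      ultimately have "cmod (u k t) \<le> \<rho> ^ (k + 1) / real (k + 1) * 2"
        unfolding u_def norm_mult using \<rho> by (intro mult_mono) auto
      then show ?thesis by (simp only: mult.commute)
    qed
  qed
  also have "(\<lambda>k. LINT t|circle_measure. f t * u k t) = (\<lambda>k. of_real (\<rho> ^ (k + 1) / (k + 1)) * fourier_coeff f (int k) * s ^ k)"
  proof
    fix k
    define r where "r = complex_of_real (\<rho> ^ (k + 1) / (k + 1))"
    have i: "integrable circle_measure (\<lambda>t. f t * t powi m)" for m
      by (rule integrable_mult_bounded[OF Hardy1_integrable[OF f], of _ 1])
         (auto intro!: continuous_on_sphere_imp_measurable continuous_intros simp: norm_power_int)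
    have "f t * u k t = (r * s ^ k) * (f t * t powi (- int k)) - (r * inverse s ^ (k + 2)) * (f t * t powi (int k + 2))" for t
    proof -
      have "(t / s) powi (- int k) = t powi (- int k) * s ^ k"
        using s0 by (simp add: power_int_divide_distrib power_int_minus field_simps)
      moreover have "t ^ (k + 2) = t powi (int k + 2)"
        by (metis of_nat_add of_nat_numeral power_int_of_nat)
      then have "(t / s) ^ (k + 2) = t powi (int k + 2) * inverse s ^ (k + 2)"
        by (simp only: divide_inverse power_mult_distrib)
      ultimately show ?thesis
        unfolding u_def r_def[symmetric] by (simp only: right_diff_distrib mult_ac)
    qed
    then have "(LINT t|circle_measure. f t * u k t) =
       (LINT t|circle_measure. (r * s ^ k) * (f t * t powi (- int k))) - (LINT t|circle_measure. (r * inverse s ^ (k + 2)) * (f t * t powi (int k + 2)))"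
      using i by (simp only: Bochner_Integration.integral_diff integrable_mult_right)
    also have "\<dots> = (r * s ^ k) * fourier_coeff f (int k) - (r * inverse s ^ (k + 2)) * fourier_coeff f (- (int k + 2))"
      unfolding fourier_coeff_def by (simp only: integral_mult_right_zero minus_minus)
    also have "fourier_coeff f (- (int k + 2)) = 0" using f by (simp add: Hardy1_def)
    finally show "(LINT t|circle_measure. f t * u k t) = of_real (\<rho> ^ (k + 1) / (k + 1)) * fourier_coeff f (int k) * s ^ k"
      by (simp add: r_def mult_ac)
  qed
  finally show ?thesis .
qed

text \<open>
  By the series, a power series of radius of convergence at least \<open>1 / \<rho>\<close>.
\<close>

lemma continuous_on_hilbert_convolution:
  assumes f: "f \<in> Hardy1" and \<rho>: "0 < \<rho>" "\<rho> < 1"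
  shows "continuous_on (sphere 0 1) (hilbert_convolution \<rho> f)"
proof -
  define c where "c k = of_real (\<rho> ^ (k + 1) / (k + 1)) * fourier_coeff f (int k)" for k :: nat
  define C where "C = (LINT \<zeta>|circle_measure. cmod (f \<zeta>))"
  have C: "cmod (fourier_coeff f k) \<le> C" "0 \<le> C" for k
    unfolding C_def using f by (auto intro: cmod_fourier_coeff_le Hardy1_integrable)
  \<comment> \<open>a point strictly between the unit circle and the circle of convergence\<close>
  define K where "K = complex_of_real (1 / sqrt \<rho>)"
  have K: "cmod K = 1 / sqrt \<rho>" using \<rho> by (simp add: K_def norm_divide)
  have "summable (\<lambda>k. c k * K ^ k)"
  proof (rule summable_comparison_test')
    show "summable (\<lambda>k. C * sqrt \<rho> ^ k)" using \<rho> by (intro summable_mult summable_geometric) simp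
    fix k :: nat
    have "cmod (c k * K ^ k) = \<rho> ^ (k + 1) / (k + 1) * cmod (fourier_coeff f (int k)) * (1 / sqrt \<rho>) ^ k"
      unfolding c_def norm_mult norm_power K using \<rho> by (subst norm_of_real) simp
    also have "\<dots> \<le> \<rho> ^ k * C * (1 / sqrt \<rho>) ^ k"
    proof (intro mult_right_mono mult_mono C)
      show "\<rho> ^ (k + 1) / real (k + 1) \<le> \<rho> ^ k" using \<rho> by (intro kernel_coeff_le) auto
    qed (use \<rho> in auto)
    also have "\<dots> = C * (\<rho> * (1 / sqrt \<rho>)) ^ k" by (simp only: power_mult_distrib mult_ac)
    also have "\<rho> * (1 / sqrt \<rho>) = sqrt \<rho>" using \<rho> by (simp add: real_div_sqrt)
    finally show "norm (c k * K ^ k) \<le> C * sqrt \<rho> ^ k" .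
  qed
  then have "isCont (\<lambda>s. \<Sum>k. c k * s ^ k) s" if "cmod s = 1" for s
    by (rule isCont_powser) (use that K \<rho> in simp)
  then have "continuous_on (sphere 0 1) (\<lambda>s. \<Sum>k. c k * s ^ k)"
    by (auto intro!: continuous_at_imp_continuous_on)
  also have "?this \<longleftrightarrow> ?thesis"
    by (rule continuous_on_cong) (use hilbert_convolution_sums[OF f, of \<rho>] \<rho> in \<open>auto simp: c_def sums_iff\<close>)
  finally show ?thesis .
qed

lemma cmod_hilbert_convolution_le:
  assumes "integrable circle_measure f" "0 \<le> \<rho>" "\<rho> < 1" "cmod s = 1"
  shows "cmod (hilbert_convolution \<rho> f s) \<le> pi * (LINT \<zeta>|circle_measure. cmod (f \<zeta>))"
  unfolding hilbert_convolution_def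
  by (rule cmod_integral_mult_le)
     (use assms in \<open>auto intro!: continuous_on_sphere_imp_measurable continuous_on_hilbert_kernel cmod_hilbert_kernel_le_pi simp: norm_divide\<close>)

section \<open>The Carleman embedding on concentric disks\<close>

lemma carleman_sums:
  assumes f: "f \<in> Hardy1" and z: "cmod z < 1"
  shows "(\<lambda>n. fourier_coeff f (int n) * z ^ n) sums carleman f z"
  unfolding carleman_def
proof (rule summable_sums, rule summable_comparison_test')
  show "summable (\<lambda>n. (LINT \<zeta>|circle_measure. cmod (f \<zeta>)) * cmod z ^ n)"
    using z by (intro summable_mult summable_geometric) simp
  show "norm (fourier_coeff f (int n) * z ^ n) \<le> (LINT \<zeta>|circle_measure. cmod (f \<zeta>)) * cmod z ^ n" for n
    using cmod_fourier_coeff_le[OF Hardy1_integrable[OF f], of "int n"]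
    by (simp add: norm_mult norm_power mult_right_mono)
qed

lemma cmod_carleman_le:
  assumes f: "f \<in> Hardy1" and z: "cmod z \<le> r" "r < 1"
  shows "cmod (carleman f z) \<le> (LINT \<zeta>|circle_measure. cmod (f \<zeta>)) / (1 - r)"
proof -
  have r: "\<bar>r\<bar> < 1" using z norm_ge_zero[of z] by linarith
  have "cmod (carleman f z) \<le> (\<Sum>n. (LINT \<zeta>|circle_measure. cmod (f \<zeta>)) * r ^ n)"
    unfolding carleman_def
  proof (rule norm_suminf_le)
    fix n
    have "cmod z ^ n \<le> r ^ n" using z by (intro power_mono) auto
    then show "norm (fourier_coeff f (int n) * z ^ n) \<le> (LINT \<zeta>|circle_measure. cmod (f \<zeta>)) * r ^ n"
      unfolding norm_mult norm_power
      by (intro mult_mono cmod_fourier_coeff_le Hardy1_integrable f) auto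
  qed (use r in \<open>intro summable_mult summable_geometric, simp\<close>)
  also have "\<dots> = (LINT \<zeta>|circle_measure. cmod (f \<zeta>)) / (1 - r)"
    using r by (simp add: suminf_mult suminf_geometric summable_geometric)
  finally show ?thesis .
qed

lemma carleman_holomorphic:
  assumes "f \<in> Hardy1"
  shows "carleman f holomorphic_on ball 0 1"
  by (rule power_series_holomorphic[where a = "\<lambda>n. fourier_coeff f (int n)"])
     (use carleman_sums[OF assms] in auto)

lemma carleman_measurable [measurable]: "carleman f \<in> borel_measurable borel"
  unfolding carleman_def[abs_def]
  by (intro borel_measurable_suminf borel_measurable_continuous_onI continuous_intros)

text \<open>
  On a smaller disk the partial sums of both power series are uniformly bounded, so the orthogonality of
  monomials can be applied termwise.
\<close>

lemma carleman_gram_sums: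
  assumes f: "f \<in> Hardy1" and g: "g \<in> Hardy1" and r: "0 < r" "r < 1"
  shows "(\<lambda>k. of_real ((r\<^sup>2) ^ (k + 1) / (k + 1)) * fourier_coeff f (int k) * cnj (fourier_coeff g (int k)))
    sums (LINT z|disk_measure. indicator (ball 0 r) z *\<^sub>R (carleman f z * cnj (carleman g z)))"
proof -
  define a where "a k = fourier_coeff f (int k)" for k
  define b where "b k = fourier_coeff g (int k)" for k
  define A where "A = (LINT \<zeta>|circle_measure. cmod (f \<zeta>))"
  define B where "B = (LINT \<zeta>|circle_measure. cmod (g \<zeta>))"
  have A: "cmod (a k) \<le> A" for k
    unfolding A_def a_def using f by (auto intro: cmod_fourier_coeff_le Hardy1_integrable)
  have B: "cmod (b k) \<le> B" for k
    unfolding B_def b_def using g by (auto intro: cmod_fourier_coeff_le Hardy1_integrable)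
  have A0: "0 \<le> A" "0 \<le> B" unfolding A_def B_def by auto
  have partial: "cmod (\<Sum>k<N. c k * z ^ k) \<le> C / (1 - r)"
    if c: "\<And>k. cmod (c k) \<le> C" and z: "cmod z < r" and C: "0 \<le> C" for c C N and z :: complex
  proof -
    have "cmod (\<Sum>k<N. c k * z ^ k) \<le> (\<Sum>k<N. C * r ^ k)"
    proof (rule order_trans[OF norm_sum], rule sum_mono)
      fix k
      have "cmod z ^ k \<le> r ^ k" using z by (intro power_mono) auto
      then show "cmod (c k * z ^ k) \<le> C * r ^ k"
        unfolding norm_mult norm_power using c C by (intro mult_mono) auto
    qed
    also have "\<dots> = C * (\<Sum>k<N. r ^ k)" by (simp add: sum_distrib_left)
    also have "\<dots> \<le> C * (1 / (1 - r))"
      using r C by (intro mult_left_mono) (simp_all add: sum_gp_strict divide_right_mono)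
    finally show ?thesis by simp
  qed
  define S where "S N z = indicator (ball 0 r) z *\<^sub>R ((\<Sum>k<N. a k * z ^ k) * cnj (\<Sum>k<N. b k * z ^ k))" for N and z :: complex
  have "(\<lambda>N. LINT z|disk_measure. S N z) \<longlonglongrightarrow>
     (LINT z|disk_measure. indicator (ball 0 r) z *\<^sub>R (carleman f z * cnj (carleman g z)))"
  proof (rule integral_dominated_convergence)
    show "(\<lambda>z. indicator (ball 0 r) z *\<^sub>R (carleman f z * cnj (carleman g z))) \<in> borel_measurable disk_measure"
      by (rule measurable_disk_measureI)
        (intro borel_measurable_scaleR borel_measurable_indicator borel_measurable_times borel_measurable_cnj carleman_measurable, simp)
    show "S N \<in> borel_measurable disk_measure" for N
      unfolding S_def
      by (rule measurable_disk_measureI)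
        (intro borel_measurable_scaleR borel_measurable_indicator borel_measurable_continuous_onI continuous_intros, simp)
    show "integrable disk_measure (\<lambda>_. A / (1 - r) * (B / (1 - r)))" by simp
    show "AE z in disk_measure. norm (S N z) \<le> A / (1 - r) * (B / (1 - r))" for N
    proof (rule AE_I2)
      fix z
      have pos: "0 \<le> A / (1 - r)" "0 \<le> B / (1 - r)" using A0 r by auto
      show "norm (S N z) \<le> A / (1 - r) * (B / (1 - r))"
      proof (cases "z \<in> ball 0 r")
        case True
        then have z: "cmod z < r" by simp
        have "norm (S N z) = cmod (\<Sum>k<N. a k * z ^ k) * cmod (\<Sum>k<N. b k * z ^ k)"
          using True by (simp add: S_def norm_mult del: cnj_sum)
        also have "\<dots> \<le> A / (1 - r) * (B / (1 - r))"
          using pos by (intro mult_mono partial A B A0 z) auto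
        finally show ?thesis .
      next
        case False
        then have "norm (S N z) = 0" by (simp add: S_def)
        then show ?thesis using mult_nonneg_nonneg[OF pos] by simp
      qed
    qed
    show "AE z in disk_measure. (\<lambda>N. S N z) \<longlonglongrightarrow> indicator (ball 0 r) z *\<^sub>R (carleman f z * cnj (carleman g z))"
    proof (rule AE_I2)
      fix z assume "z \<in> space disk_measure"
      then have z: "cmod z < 1" by simp
      show "(\<lambda>N. S N z) \<longlonglongrightarrow> indicator (ball 0 r) z *\<^sub>R (carleman f z * cnj (carleman g z))"
        unfolding S_def a_def b_def
        using carleman_sums[OF f z] carleman_sums[OF g z]
        by (intro tendsto_scaleR tendsto_const tendsto_mult tendsto_cnj) (simp_all add: sums_def)
    qed
  qed
  also have "(\<lambda>N. LINT z|disk_measure. S N z) = (\<lambda>N. \<Sum>k<N. of_real ((r\<^sup>2) ^ (k + 1) / (k + 1)) * a k * cnj (b k))"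
  proof
    fix N
    have i: "integrable disk_measure (\<lambda>z. (a k * cnj (b l)) * (indicator (ball 0 r) z *\<^sub>R (z ^ k * cnj (z ^ l))))" for k l
    proof (rule integrable_mult_right, rule disk.integrable_const_bound[where B = 1], rule AE_I2)
      fix z assume "z \<in> space disk_measure"
      then have "cmod z ^ k * cmod z ^ l \<le> 1" by (intro mult_le_one power_le_one) auto
      then show "norm (indicator (ball 0 r) z *\<^sub>R (z ^ k * cnj (z ^ l))) \<le> 1"
        by (simp add: indicator_def norm_mult norm_power)
    next
      show "(\<lambda>z. indicator (ball 0 r) z *\<^sub>R (z ^ k * cnj (z ^ l))) \<in> borel_measurable disk_measure"
        by (rule measurable_disk_measureI)
          (intro borel_measurable_scaleR borel_measurable_indicator borel_measurable_continuous_onI continuous_intros, simp)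
    qed
    have "S N z = (\<Sum>k<N. \<Sum>l<N. (a k * cnj (b l)) * (indicator (ball 0 r) z *\<^sub>R (z ^ k * cnj (z ^ l))))" for z
      by (simp add: S_def sum_product scaleR_sum_right mult_ac)
    then have "(LINT z|disk_measure. S N z) =
        (\<Sum>k<N. \<Sum>l<N. (a k * cnj (b l)) * (LINT z|disk_measure. indicator (ball 0 r) z *\<^sub>R (z ^ k * cnj (z ^ l))))"
      by (simp only: Bochner_Integration.integral_sum[OF Bochner_Integration.integrable_sum[OF i]]
          Bochner_Integration.integral_sum[OF i] integral_mult_right_zero)
    also have "\<dots> = (\<Sum>k<N. \<Sum>l<N. if k = l then of_real ((r\<^sup>2) ^ (k + 1) / (k + 1)) * a k * cnj (b k) else 0)"
      using r by (intro sum.cong refl) (simp add: integral_monomials_ball del: complex_cnj_power)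
    also have "\<dots> = (\<Sum>k<N. of_real ((r\<^sup>2) ^ (k + 1) / (k + 1)) * a k * cnj (b k))"
      by simp
    finally show "(LINT z|disk_measure. S N z) = (\<Sum>k<N. of_real ((r\<^sup>2) ^ (k + 1) / (k + 1)) * a k * cnj (b k))" .
  qed
  finally show ?thesis unfolding sums_def a_def b_def .
qed

text \<open>
  The disk of radius \<open>r\<close> contributes the weights \<open>(r\<^sup>2)\<^sup>k\<^sup>+\<^sup>1 / (k + 1)\<close>, which are exactly the coefficients
  of the kernel for \<open>\<rho> = r\<^sup>2\<close>.
\<close>

lemma carleman_gram_eq_hilbert:
  assumes f: "f \<in> Hardy1" and g: "g \<in> Hardy1" and r: "0 < r" "r < 1"
  shows "(LINT z|disk_measure. indicator (ball 0 r) z *\<^sub>R (carleman f z * cnj (carleman g z))) =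
    (LINT s|circle_measure. f s * cnj (hilbert_convolution (r\<^sup>2) g s))"
proof (rule sums_unique2[OF carleman_gram_sums[OF assms]])
  have \<rho>: "0 \<le> r\<^sup>2" "r\<^sup>2 < 1" using r by (simp_all add: power_less_one_iff)
  define C where "C = (LINT \<zeta>|circle_measure. cmod (g \<zeta>))"
  define u where "u k s = cnj (of_real ((r\<^sup>2) ^ (k + 1) / (k + 1)) * fourier_coeff g (int k) * s ^ k)" for k :: nat and s
  have "(\<lambda>k. LINT s|circle_measure. f s * u k s) sums (LINT s|circle_measure. f s * cnj (hilbert_convolution (r\<^sup>2) g s))"
  proof (rule integral_mult_sums)
    show "integrable circle_measure f" using f by (rule Hardy1_integrable)
    show "u k \<in> borel_measurable circle_measure" for k
      unfolding u_def by (intro continuous_on_sphere_imp_measurable continuous_intros)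
    show "summable (\<lambda>k. C * ((r\<^sup>2) ^ (k + 1) / real (k + 1)))"
      by (rule summable_kernel_coeffs[OF \<rho>])
    fix s assume "s \<in> space circle_measure"
    then have s: "cmod s = 1" by simp
    show "(\<lambda>k. u k s) sums cnj (hilbert_convolution (r\<^sup>2) g s)"
      unfolding u_def sums_cnj by (rule hilbert_convolution_sums[OF g \<rho> s])
    fix k
    have "cmod (fourier_coeff g (int k)) \<le> C"
      unfolding C_def by (rule cmod_fourier_coeff_le[OF Hardy1_integrable[OF g]])
    moreover have "cmod (of_real ((r\<^sup>2) ^ (k + 1) / (k + 1))) = (r\<^sup>2) ^ (k + 1) / real (k + 1)"
      by (subst norm_of_real) simp
    ultimately show "cmod (u k s) \<le> C * ((r\<^sup>2) ^ (k + 1) / real (k + 1))"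
      unfolding u_def complex_mod_cnj norm_mult norm_power s
      by (simp add: mult.commute[of C] mult_left_mono divide_right_mono)
  qed
  also have "(\<lambda>k. LINT s|circle_measure. f s * u k s) =
     (\<lambda>k. of_real ((r\<^sup>2) ^ (k + 1) / (k + 1)) * fourier_coeff f (int k) * cnj (fourier_coeff g (int k)))"
  proof
    fix k
    have "(LINT s|circle_measure. f s * u k s) =
      (LINT s|circle_measure. (of_real ((r\<^sup>2) ^ (k + 1) / (k + 1)) * cnj (fourier_coeff g (int k))) * (f s * s powi (- int k)))"
    proof (rule Bochner_Integration.integral_cong[OF refl])
      fix s assume "s \<in> space circle_measure"
      then have s: "cmod s = 1" by simp
      then have "cnj s * s = 1" by (metis complex_norm_square mult.commute of_real_1 power_one)
      then have "cnj s = inverse s" by (metis inverse_unique mult.commute)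
      then have "cnj (s ^ k) = s powi (- int k)" by (simp add: power_int_minus power_inverse)
      then show "f s * u k s = (of_real ((r\<^sup>2) ^ (k + 1) / (k + 1)) * cnj (fourier_coeff g (int k))) * (f s * s powi (- int k))"
        unfolding u_def complex_cnj_mult complex_cnj_complex_of_real by (simp only: mult_ac)
    qed
    also have "\<dots> = (of_real ((r\<^sup>2) ^ (k + 1) / (k + 1)) * cnj (fourier_coeff g (int k))) * fourier_coeff f (int k)"
      unfolding fourier_coeff_def[of f] by (rule integral_mult_right_zero)
    finally show "(LINT s|circle_measure. f s * u k s) = of_real ((r\<^sup>2) ^ (k + 1) / (k + 1)) * fourier_coeff f (int k) * cnj (fourier_coeff g (int k))"
      by (simp only: mult_ac)
  qed
  finally show "(\<lambda>k. of_real ((r\<^sup>2) ^ (k + 1) / (k + 1)) * fourier_coeff f (int k) * cnj (fourier_coeff g (int k)))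
    sums (LINT s|circle_measure. f s * cnj (hilbert_convolution (r\<^sup>2) g s))" .
qed

text \<open>
  Any sequence of radii in \<open>(0, 1)\<close> increasing to \<open>1\<close> would do.
\<close>

definition radius :: "nat \<Rightarrow> real" where
  "radius N = 1 - 1 / real (N + 2)"

lemma radius: "0 < radius N" "radius N < 1"
  by (simp_all add: radius_def)

lemma radius_mono: "M \<le> N \<Longrightarrow> radius M \<le> radius N"
  unfolding radius_def by (intro diff_left_mono divide_left_mono) auto

lemma indicator_radius_eventually:
  assumes "cmod z < 1"
  shows "eventually (\<lambda>N. indicator (ball 0 (radius N)) z = (1 :: real)) sequentially"
proof -
  have "radius \<longlonglongrightarrow> 1 - 0"
    unfolding radius_def
    by (intro tendsto_diff tendsto_const) (rule LIMSEQ_ignore_initial_segment[OF lim_1_over_n])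
  then have "eventually (\<lambda>N. cmod z < radius N) sequentially"
    using assms by (intro order_tendstoD) auto
  then show ?thesis by eventually_elim simp
qed

text \<open>
  The integral of \<open>\<bar>F\<bar>\<^sup>2\<close> over smaller disks is at most \<open>\<pi> \<parallel>f\<parallel>\<^sub>1\<^sup>2\<close>, because it equals a double integral
  against a kernel bounded by \<open>\<pi>\<close>.
\<close>

lemma carleman_square_integrable:
  assumes f: "f \<in> Hardy1"
  shows "carleman f \<in> square_integrable disk_measure"
proof -
  define C where "C = (LINT \<zeta>|circle_measure. cmod (f \<zeta>))"
  define s where "s N z = indicator (ball 0 (radius N)) z * (cmod (carleman f z))\<^sup>2" for N z
  have eq: "complex_of_real (s N z) = indicator (ball 0 (radius N)) z *\<^sub>R (carleman f z * cnj (carleman f z))" for N z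
    by (simp only: s_def of_real_mult scaleR_conv_of_real complex_norm_square)
  have bound: "(LINT z|disk_measure. s N z) \<le> pi * C * C" for N
  proof -
    have r2: "0 < (radius N)\<^sup>2" "(radius N)\<^sup>2 < 1" using radius[of N] by (simp_all add: power_less_one_iff)
    have "cmod (complex_of_real (LINT z|disk_measure. s N z)) =
        cmod (LINT s|circle_measure. f s * cnj (hilbert_convolution ((radius N)\<^sup>2) f s))"
      unfolding carleman_gram_eq_hilbert[OF f f radius, symmetric] eq[symmetric] integral_complex_of_real ..
    also have "\<dots> \<le> pi * C * (LINT \<zeta>|circle_measure. cmod (f \<zeta>))"
    proof (rule cmod_integral_mult_le[OF Hardy1_integrable[OF f]])
      show "(\<lambda>s. cnj (hilbert_convolution ((radius N)\<^sup>2) f s)) \<in> borel_measurable circle_measure"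
        using r2 by (intro continuous_on_sphere_imp_measurable continuous_intros continuous_on_hilbert_convolution f)
    next
      fix x assume "x \<in> space circle_measure"
      then show "cmod (cnj (hilbert_convolution ((radius N)\<^sup>2) f x)) \<le> pi * C"
        unfolding C_def complex_mod_cnj using r2
        by (intro cmod_hilbert_convolution_le Hardy1_integrable f) auto
    qed
    finally show ?thesis by (simp add: C_def)
  qed
  have int: "integrable disk_measure (s N)" for N
  proof (rule disk.integrable_const_bound[where B = "(C / (1 - radius N))\<^sup>2"], rule AE_I2)
    fix z
    show "norm (s N z) \<le> (C / (1 - radius N))\<^sup>2"
    proof (cases "z \<in> ball 0 (radius N)")
      case True
      then have "cmod (carleman f z) \<le> C / (1 - radius N)"
        unfolding C_def using radius[of N] by (intro cmod_carleman_le f) auto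
      then have "(cmod (carleman f z))\<^sup>2 \<le> (C / (1 - radius N))\<^sup>2"
        by (intro power_mono) auto
      then show ?thesis using True by (simp add: s_def)
    qed (simp add: s_def)
    show "s N \<in> borel_measurable disk_measure"
      unfolding s_def
      by (rule measurable_disk_measureI)
        (intro borel_measurable_times borel_measurable_indicator borel_measurable_power
          measurable_compose[OF carleman_measurable borel_measurable_norm], simp)
  qed
  have mono: "s M z \<le> s N z" if "M \<le> N" for M N z
    using radius_mono[OF that] by (auto simp: s_def indicator_def intro!: mult_right_mono)
  have "incseq (\<lambda>N. LINT z|disk_measure. s N z)"
    by (intro monoI integral_mono int mono)
  then obtain L where L: "(\<lambda>N. LINT z|disk_measure. s N z) \<longlonglongrightarrow> L"
    using incseq_convergent[of _ "pi * C * C"] bound by blast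
  have "integrable disk_measure (\<lambda>z. (cmod (carleman f z))\<^sup>2)"
  proof (rule integrable_monotone_convergence[OF int _ _ L])
    show "AE z in disk_measure. mono (\<lambda>N. s N z)" by (intro AE_I2 monoI mono)
    show "AE z in disk_measure. (\<lambda>N. s N z) \<longlonglongrightarrow> (cmod (carleman f z))\<^sup>2"
    proof (rule AE_I2)
      fix z assume "z \<in> space disk_measure"
      then have "eventually (\<lambda>N. indicator (ball 0 (radius N)) z = (1::real)) sequentially"
        by (intro indicator_radius_eventually) simp
      then have "eventually (\<lambda>N. s N z = (cmod (carleman f z))\<^sup>2) sequentially"
        by eventually_elim (simp add: s_def)
      then show "(\<lambda>N. s N z) \<longlonglongrightarrow> (cmod (carleman f z))\<^sup>2" by (rule tendsto_eventually)
    qed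
  qed (auto intro!: measurable_disk_measureI)
  then show ?thesis
    by (simp add: square_integrable_def measurable_disk_measureI carleman_measurable)
qed

section \<open>The upper bound\<close>

text \<open>
  For fixed \<open>s\<close> this applies \<open>f\<close>, as a contraction \<open>L\<^sup>\<infinity> \<rightarrow> M\<^sub>n\<close>, to a single scalar function bounded by \<open>\<pi>\<close>,
  that is, to a test matrix of size one.
\<close>

lemma matrix_op_norm_hilbert_convolution_le_pi:
  assumes f: "L1_matrix_norm n f \<le> 1" and \<rho>: "0 \<le> \<rho>" "\<rho> < 1" and s: "cmod s = 1"
  shows "matrix_op_norm {..<n} (\<lambda>i j. hilbert_convolution \<rho> (f i j) s) \<le> pi"
proof -
  define g where "g t = hilbert_kernel \<rho> (t / s) / of_real pi" for t
  have "matrix_op_norm ({..<1::nat} \<times> {..<n}) (\<lambda>(k, i) (l, j). LINT t|circle_measure. f i j t * g t) \<le> 1"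
  proof (rule integral_against_continuous_le_L1_norm[OF _ _ f])
    show "continuous_on (sphere 0 1) g"
      unfolding g_def by (intro continuous_intros continuous_on_hilbert_kernel \<rho> s) simp
    fix \<zeta> :: complex assume "cmod \<zeta> = 1"
    then have "cmod (hilbert_kernel \<rho> (\<zeta> / s)) \<le> pi"
      by (intro cmod_hilbert_kernel_le_pi \<rho>) (simp add: norm_divide s)
    then have "cmod (g \<zeta>) \<le> 1" by (simp add: g_def norm_divide)
    moreover have "{..<1::nat} = {0}" by auto
    ultimately show "matrix_op_norm {..<1::nat} (\<lambda>k l. g \<zeta>) \<le> 1"
      by (simp add: matrix_op_norm_singleton)
  qed
  also have "matrix_op_norm ({..<1::nat} \<times> {..<n}) (\<lambda>(k, i) (l, j). LINT t|circle_measure. f i j t * g t) =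
     matrix_op_norm {..<n} (\<lambda>i j. LINT t|circle_measure. f i j t * g t)"
  proof -
    have "bij_betw (\<lambda>i. (0::nat, i)) {..<n} ({..<1} \<times> {..<n})"
      by (auto simp: bij_betw_def inj_on_def)
    from matrix_op_norm_reindex[OF this, of "\<lambda>(k, i) (l, j). LINT t|circle_measure. f i j t * g t"]
    show ?thesis by simp
  qed
  finally have le: "matrix_op_norm {..<n} (\<lambda>i j. LINT t|circle_measure. f i j t * g t) \<le> 1" .
  have "hilbert_convolution \<rho> (f i j) s = of_real pi * (LINT t|circle_measure. f i j t * g t)" for i j
  proof -
    have "f i j t * hilbert_kernel \<rho> (t / s) = of_real pi * (f i j t * g t)" for t
      by (simp add: g_def)
    then show ?thesis unfolding hilbert_convolution_def by (simp only: integral_mult_right_zero)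
  qed
  then have "matrix_op_norm {..<n} (\<lambda>i j. hilbert_convolution \<rho> (f i j) s) \<le>
      cmod (of_real pi) * matrix_op_norm {..<n} (\<lambda>i j. LINT t|circle_measure. f i j t * g t)"
    by (simp only: matrix_op_norm_scale_le finite_lessThan)
  also have "\<dots> \<le> pi * 1"
    using le by (intro mult_mono) (auto intro: matrix_op_norm_nonneg)
  finally show ?thesis by simp
qed

text \<open>
  Now \<open>f\<close> is applied to an \<open>n \<times> n\<close> test matrix built from \<open>f\<close> itself; the previous lemma bounds its norm.
  The tensor factor of the test matrix comes first in the norm of \<open>M\<^sub>n \<otimes> M\<^sub>n\<close>, whence the flip.
\<close>

lemma matrix_op_norm_ball_gram_le_pi:
  assumes f: "\<And>i j. i < n \<Longrightarrow> j < n \<Longrightarrow> f i j \<in> Hardy1" and norm: "L1_matrix_norm n f \<le> 1"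
    and r: "0 < r" "r < 1"
  shows "matrix_op_norm ({..<n} \<times> {..<n}) (\<lambda>(i, p) (j, q).
     LINT z|disk_measure. indicator (ball 0 r) z *\<^sub>R (carleman (f i j) z * cnj (carleman (f p q) z))) \<le> pi"
proof -
  have \<rho>: "0 < r\<^sup>2" "r\<^sup>2 < 1" using r by (simp_all add: power_less_one_iff)
  define g where "g k l s = of_real (1 / pi) * cnj (hilbert_convolution (r\<^sup>2) (f k l) s)" for k l s
  define B where "B = (\<lambda>(k, i) (l, j). LINT s|circle_measure. f i j s * g k l s)"
  have B: "matrix_op_norm ({..<n} \<times> {..<n}) B \<le> 1"
    unfolding B_def
  proof (rule integral_against_continuous_le_L1_norm[OF _ _ norm])
    show "continuous_on (sphere 0 1) (g k l)" if "k < n" "l < n" for k l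
      unfolding g_def by (intro continuous_intros continuous_on_hilbert_convolution f that \<rho>)
    fix \<zeta> :: complex assume \<zeta>: "cmod \<zeta> = 1"
    have "matrix_op_norm {..<n} (\<lambda>k l. g k l \<zeta>) \<le>
        cmod (of_real (1 / pi)) * matrix_op_norm {..<n} (\<lambda>k l. cnj (hilbert_convolution (r\<^sup>2) (f k l) \<zeta>))"
      unfolding g_def by (rule matrix_op_norm_scale_le) simp
    also have "\<dots> \<le> (1 / pi) * pi"
      unfolding matrix_op_norm_cnj
      using matrix_op_norm_hilbert_convolution_le_pi[OF norm _ \<rho>(2) \<zeta>] \<rho>(1)
      by (intro mult_mono) (auto intro: matrix_op_norm_nonneg simp: norm_divide)
    finally show "matrix_op_norm {..<n} (\<lambda>k l. g k l \<zeta>) \<le> 1" by simp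
  qed
  have entry: "(LINT z|disk_measure. indicator (ball 0 r) z *\<^sub>R (carleman (f i j) z * cnj (carleman (f p q) z)))
     = of_real pi * B (p, i) (q, j)" if "i < n" "j < n" "p < n" "q < n" for i j p q
  proof -
    have "f i j s * cnj (hilbert_convolution (r\<^sup>2) (f p q) s) = of_real pi * (f i j s * g p q s)" for s
      by (simp add: g_def)
    then show ?thesis
      unfolding carleman_gram_eq_hilbert[OF f[OF that(1,2)] f[OF that(3,4)] r] B_def
      by (simp only: prod.case integral_mult_right_zero)
  qed
  have "matrix_op_norm ({..<n} \<times> {..<n}) (\<lambda>(i, p) (j, q).
     LINT z|disk_measure. indicator (ball 0 r) z *\<^sub>R (carleman (f i j) z * cnj (carleman (f p q) z)))
    = matrix_op_norm ({..<n} \<times> {..<n}) (\<lambda>a b. of_real pi * B (prod.swap a) (prod.swap b))"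
    by (rule matrix_op_norm_cong) (auto simp: entry)
  also have "\<dots> = matrix_op_norm ({..<n} \<times> {..<n}) (\<lambda>a b. of_real pi * B a b)"
    by (rule matrix_op_norm_reindex) (auto simp: bij_betw_def)
  also have "\<dots> \<le> cmod (of_real pi) * matrix_op_norm ({..<n} \<times> {..<n}) B"
    by (rule matrix_op_norm_scale_le) simp
  also have "\<dots> \<le> pi * 1"
    using B by (intro mult_mono) (auto intro: matrix_op_norm_nonneg)
  finally show ?thesis by simp
qed

lemma matrix_op_norm_gram_le_pi:
  assumes f: "\<And>i j. i < n \<Longrightarrow> j < n \<Longrightarrow> f i j \<in> Hardy1" and norm: "L1_matrix_norm n f \<le> 1"
  shows "matrix_op_norm ({..<n} \<times> {..<n}) (\<lambda>(i, p) (j, q).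
     LINT z|disk_measure. carleman (f i j) z * cnj (carleman (f p q) z)) \<le> pi"
proof (rule matrix_op_norm_lim_le)
  show "eventually (\<lambda>N. matrix_op_norm ({..<n} \<times> {..<n}) (\<lambda>(i, p) (j, q).
     LINT z|disk_measure. indicator (ball 0 (radius N)) z *\<^sub>R (carleman (f i j) z * cnj (carleman (f p q) z))) \<le> pi) sequentially"
    by (intro always_eventually allI matrix_op_norm_ball_gram_le_pi f norm radius)
  have "(\<lambda>N. LINT z|disk_measure. indicator (ball 0 (radius N)) z *\<^sub>R (carleman (f i j) z * cnj (carleman (f p q) z)))
      \<longlonglongrightarrow> (LINT z|disk_measure. carleman (f i j) z * cnj (carleman (f p q) z))"
    if "i < n" "j < n" "p < n" "q < n" for i j p q
  proof (rule integral_dominated_convergence)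
    let ?h = "\<lambda>z. carleman (f i j) z * cnj (carleman (f p q) z)"
    have int: "integrable disk_measure ?h"
      by (intro square_integrable_mult_cnj carleman_square_integrable f that)
    show "integrable disk_measure (\<lambda>z. norm (?h z))" using int by (rule integrable_norm)
    show "?h \<in> borel_measurable disk_measure" using int by (rule borel_measurable_integrable)
    show "(\<lambda>z. indicator (ball 0 (radius N)) z *\<^sub>R ?h z) \<in> borel_measurable disk_measure" for N
      by (rule measurable_disk_measureI)
        (intro borel_measurable_scaleR borel_measurable_indicator borel_measurable_times borel_measurable_cnj carleman_measurable, simp)
    show "AE z in disk_measure. norm (indicator (ball 0 (radius N)) z *\<^sub>R ?h z) \<le> norm (?h z)" for N
      by (intro AE_I2) (auto simp: indicator_def)
    show "AE z in disk_measure. (\<lambda>N. indicator (ball 0 (radius N)) z *\<^sub>R ?h z) \<longlonglongrightarrow> ?h z"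
    proof (rule AE_I2)
      fix z assume "z \<in> space disk_measure"
      then have "eventually (\<lambda>N. indicator (ball 0 (radius N)) z = (1::real)) sequentially"
        by (intro indicator_radius_eventually) simp
      then have "eventually (\<lambda>N. indicator (ball 0 (radius N)) z *\<^sub>R ?h z = ?h z) sequentially"
        by eventually_elim simp
      then show "(\<lambda>N. indicator (ball 0 (radius N)) z *\<^sub>R ?h z) \<longlonglongrightarrow> ?h z" by (rule tendsto_eventually)
    qed
  qed
  then show "(\<lambda>N. (\<lambda>(i, p) (j, q). LINT z|disk_measure. indicator (ball 0 (radius N)) z *\<^sub>R (carleman (f i j) z * cnj (carleman (f p q) z))) a b)
     \<longlonglongrightarrow> (\<lambda>(i, p) (j, q). LINT z|disk_measure. carleman (f i j) z * cnj (carleman (f p q) z)) a b"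
    if "a \<in> {..<n} \<times> {..<n}" "b \<in> {..<n} \<times> {..<n}" for a b
    using that by (auto split: prod.splits)
qed auto

lemma cb_norm_carleman_le:
  "cb_norm Hardy1 L1_matrix_norm (OH_matrix_norm disk_measure) carleman \<le> ennreal (sqrt pi)"
  unfolding cb_norm_def
proof (rule SUP_least, clarify)
  fix n f assume f: "\<forall>i<n. \<forall>j<n. f i j \<in> Hardy1" and norm: "L1_matrix_norm n f \<le> 1"
  have "OH_matrix_norm disk_measure n (\<lambda>i j. carleman (f i j)) =
     ennreal (sqrt (matrix_op_norm ({..<n} \<times> {..<n}) (\<lambda>(i, p) (j, q).
       LINT z|disk_measure. carleman (f i j) z * cnj (carleman (f p q) z))))"
    by (rule OH_matrix_norm_eq_gram) (use f in \<open>auto intro: carleman_square_integrable\<close>)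
  also have "\<dots> \<le> ennreal (sqrt pi)"
    by (intro ennreal_leI real_sqrt_le_mono matrix_op_norm_gram_le_pi) (use f norm in auto)
  finally show "OH_matrix_norm disk_measure n (\<lambda>i j. carleman (f i j)) \<le> ennreal (sqrt pi)" .
qed

section \<open>The lower bound\<close>

lemma power_mult_cnj_power_circle:
  assumes "cmod \<zeta> = 1"
  shows "\<zeta> ^ i * cnj (\<zeta> ^ j) = \<zeta> powi (int i - int j)"
proof -
  have "cnj \<zeta> * \<zeta> = 1" using assms by (metis complex_norm_square mult.commute of_real_1 power_one)
  then have "cnj \<zeta> = inverse \<zeta>" by (metis inverse_unique mult.commute)
  moreover have "\<zeta> \<noteq> 0" using assms by auto
  ultimately show ?thesis by (simp add: power_int_diff divide_inverse power_inverse)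
qed

lemma parseval_polynomial:
  "integrable circle_measure (\<lambda>\<zeta>. (cmod (\<Sum>i<n. a i * \<zeta> ^ i))\<^sup>2)"
  "(LINT \<zeta>|circle_measure. (cmod (\<Sum>i<n. a i * \<zeta> ^ i))\<^sup>2) = (\<Sum>i<n. (cmod (a i))\<^sup>2)"
proof -
  have i: "integrable circle_measure (\<lambda>\<zeta>. c * \<zeta> powi k)" for c k
    by (intro integrable_mult_right circle.integrable_const_bound[where B = 1] AE_I2)
      (auto intro!: continuous_on_sphere_imp_measurable continuous_intros simp: norm_power_int)
  have eq: "complex_of_real ((cmod (\<Sum>i<n. a i * \<zeta> ^ i))\<^sup>2) = (\<Sum>i<n. \<Sum>j<n. a i * cnj (a j) * \<zeta> powi (int i - int j))"
    if "cmod \<zeta> = 1" for \<zeta>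
  proof -
    have "complex_of_real ((cmod (\<Sum>i<n. a i * \<zeta> ^ i))\<^sup>2) = (\<Sum>i<n. \<Sum>j<n. (a i * \<zeta> ^ i) * cnj (a j * \<zeta> ^ j))"
      unfolding complex_norm_square cnj_sum sum_product ..
    also have "\<dots> = (\<Sum>i<n. \<Sum>j<n. a i * cnj (a j) * (\<zeta> ^ i * cnj (\<zeta> ^ j)))"
      by (simp add: mult_ac)
    finally show ?thesis unfolding power_mult_cnj_power_circle[OF that] .
  qed
  have "integrable circle_measure (\<lambda>\<zeta>. complex_of_real ((cmod (\<Sum>i<n. a i * \<zeta> ^ i))\<^sup>2))"
    using Bochner_Integration.integrable_sum[OF Bochner_Integration.integrable_sum[OF i]]
    by (subst Bochner_Integration.integrable_cong[OF refl eq]) auto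
  then show "integrable circle_measure (\<lambda>\<zeta>. (cmod (\<Sum>i<n. a i * \<zeta> ^ i))\<^sup>2)"
    by (rule complex_of_real_integrable_eq[THEN iffD1])
  have "complex_of_real (LINT \<zeta>|circle_measure. (cmod (\<Sum>i<n. a i * \<zeta> ^ i))\<^sup>2)
     = (LINT \<zeta>|circle_measure. (\<Sum>i<n. \<Sum>j<n. a i * cnj (a j) * \<zeta> powi (int i - int j)))"
    unfolding integral_complex_of_real[symmetric]
    by (rule Bochner_Integration.integral_cong[OF refl eq]) simp
  also have "\<dots> = (\<Sum>i<n. \<Sum>j<n. a i * cnj (a j) * (LINT \<zeta>|circle_measure. \<zeta> powi (int i - int j)))"
    by (simp only: Bochner_Integration.integral_sum[OF Bochner_Integration.integrable_sum[OF i]]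
          Bochner_Integration.integral_sum[OF i] integral_mult_right_zero)
  also have "\<dots> = (\<Sum>i<n. \<Sum>j<n. if i = j then a i * cnj (a i) else 0)"
    by (intro sum.cong refl) (simp add: integral_powi_circle)
  also have "\<dots> = (\<Sum>i<n. a i * cnj (a i))" by simp
  also have "\<dots> = complex_of_real (\<Sum>i<n. (cmod (a i))\<^sup>2)"
    by (simp only: of_real_sum complex_norm_square)
  finally show "(LINT \<zeta>|circle_measure. (cmod (\<Sum>i<n. a i * \<zeta> ^ i))\<^sup>2) = (\<Sum>i<n. (cmod (a i))\<^sup>2)"
    by (simp only: of_real_eq_iff)
qed

lemma fourier_coeff_power: "fourier_coeff (\<lambda>\<zeta>. \<zeta> ^ m) k = (if k = int m then 1 else 0)"
proof -
  have "fourier_coeff (\<lambda>\<zeta>. \<zeta> ^ m) k = (LINT \<zeta>|circle_measure. \<zeta> powi (int m - k))"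
    unfolding fourier_coeff_def
  proof (rule Bochner_Integration.integral_cong[OF refl])
    fix \<zeta> assume "\<zeta> \<in> space circle_measure"
    then have "\<zeta> \<noteq> 0" by auto
    then show "\<zeta> ^ m * \<zeta> powi (- k) = \<zeta> powi (int m - k)"
      by (simp add: power_int_diff power_int_minus divide_inverse)
  qed
  then show ?thesis by (simp add: integral_powi_circle)
qed

lemma power_mem_Hardy1: "(\<lambda>\<zeta>. \<zeta> ^ m) \<in> Hardy1"
  unfolding Hardy1_def
  by (auto simp: fourier_coeff_power norm_power intro!: circle.integrable_const_bound[where B = 1]
        continuous_on_sphere_imp_measurable continuous_intros)

lemma carleman_power: "carleman (\<lambda>\<zeta>. \<zeta> ^ m) = (\<lambda>z. z ^ m)"
proof
  fix z :: complex
  have "(\<lambda>n. (if n = m then 1 else 0) * z ^ n) sums z ^ m" by (rule powser_sums_if)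
  then show "carleman (\<lambda>\<zeta>. \<zeta> ^ m) z = z ^ m"
    by (simp add: carleman_def fourier_coeff_power sums_iff if_distrib[of "\<lambda>c. c * _"] cong: if_cong)
qed

lemma circle_Linf_integrable:
  assumes "g \<in> circle_Linf"
  shows "integrable circle_measure g"
proof -
  have [measurable]: "g \<in> borel_measurable circle_measure"
    and fin: "esssup circle_measure (\<lambda>\<zeta>. ennreal (cmod (g \<zeta>))) < \<infinity>"
    using assms by (auto simp: circle_Linf_def)
  obtain C where C: "esssup circle_measure (\<lambda>\<zeta>. ennreal (cmod (g \<zeta>))) = ennreal C" "0 \<le> C"
    using fin by (cases "esssup circle_measure (\<lambda>\<zeta>. ennreal (cmod (g \<zeta>)))") auto
  have "AE \<zeta> in circle_measure. ennreal (cmod (g \<zeta>)) \<le> ennreal C"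
    using esssup_AE[where M = circle_measure and f = "\<lambda>\<zeta>. ennreal (cmod (g \<zeta>))"] by (simp only: C(1))
  then have "AE \<zeta> in circle_measure. norm (g \<zeta>) \<le> C"
    using C(2) by (simp add: ennreal_le_iff)
  then show ?thesis by (rule circle.integrable_const_bound) simp
qed

lemma L2_set_sq: "(L2_set f I)\<^sup>2 = (\<Sum>i\<in>I. (f i)\<^sup>2)"
  by (simp add: L2_set_def sum_nonneg)

text \<open>
  Tested on vectors \<open>x, y\<close> in \<open>\<complex>\<^sup>m \<otimes> \<complex>\<^sup>n\<close>, the pairing of the Hankel matrix with \<open>g\<close> is the integral of
  \<open>\<langle>g(\<zeta>) X(\<zeta>), cnj Y(\<zeta>)\<rangle>\<close>, where \<open>X\<close> and \<open>Y\<close> are the \<open>\<complex>\<^sup>m\<close>-valued polynomials with coefficients \<open>x\<close> and \<open>y\<close>.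
  Pointwise \<open>\<parallel>g\<parallel> \<le> 1\<close> and Parseval's identity bound it.
\<close>

lemma L1_matrix_norm_hankel: "L1_matrix_norm n (\<lambda>i j \<zeta>. \<zeta> ^ (i + j)) \<le> 1"
  unfolding L1_matrix_norm_def cb_norm_def
proof (rule SUP_least, clarify)
  fix m and g :: "nat \<Rightarrow> nat \<Rightarrow> complex \<Rightarrow> complex"
  assume g: "\<forall>k<m. \<forall>l<m. g k l \<in> circle_Linf" and norm: "Linf_matrix_norm m g \<le> 1"
  define I where "I = {..<m} \<times> {..<n}"
  have "AE \<zeta> in circle_measure. ennreal (matrix_op_norm {..<m} (\<lambda>k l. g k l \<zeta>)) \<le> Linf_matrix_norm m g"
    unfolding Linf_matrix_norm_def by (rule esssup_AE)
  then have ae: "AE \<zeta> in circle_measure. matrix_op_norm {..<m} (\<lambda>k l. g k l \<zeta>) \<le> 1"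
  proof eventually_elim
    case (elim \<zeta>)
    then have "ennreal (matrix_op_norm {..<m} (\<lambda>k l. g k l \<zeta>)) \<le> 1"
      using norm by (rule order_trans)
    then show ?case by simp
  qed
  have int: "integrable circle_measure (\<lambda>\<zeta>. c * (\<zeta> ^ p * g k l \<zeta>))" if "k < m" "l < m" for k l p c
  proof -
    have "integrable circle_measure (\<lambda>\<zeta>. g k l \<zeta> * \<zeta> ^ p)"
      by (rule integrable_mult_bounded[where B = 1, OF circle_Linf_integrable])
        (use g that in \<open>auto simp: norm_power intro!: continuous_on_sphere_imp_measurable continuous_intros\<close>)
    then show ?thesis by (simp add: mult.commute)
  qed
  have "matrix_op_norm I (\<lambda>(k, i) (l, j). LINT \<zeta>|circle_measure. \<zeta> ^ (i + j) * g k l \<zeta>) \<le> 1"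
  proof (rule matrix_op_norm_leI)
    show "finite I" by (simp add: I_def)
    fix x y :: "nat \<times> nat \<Rightarrow> complex"
    assume x: "L2_set (\<lambda>j. cmod (x j)) I \<le> 1" and y: "L2_set (\<lambda>j. cmod (y j)) I \<le> 1"
    define X where "X l \<zeta> = (\<Sum>j<n. x (l, j) * \<zeta> ^ j)" for l and \<zeta> :: complex
    define Y where "Y k \<zeta> = (\<Sum>i<n. y (k, i) * \<zeta> ^ i)" for k and \<zeta> :: complex
    have sq: "(LINT \<zeta>|circle_measure. (\<Sum>k<m. (cmod (\<Sum>i<n. w (k, i) * \<zeta> ^ i))\<^sup>2)) \<le> 1"
      "integrable circle_measure (\<lambda>\<zeta>. \<Sum>k<m. (cmod (\<Sum>i<n. w (k, i) * \<zeta> ^ i))\<^sup>2)"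
      if w: "L2_set (\<lambda>j. cmod (w j)) I \<le> 1" for w
    proof -
      have "(LINT \<zeta>|circle_measure. (\<Sum>k<m. (cmod (\<Sum>i<n. w (k, i) * \<zeta> ^ i))\<^sup>2)) = (\<Sum>k<m. \<Sum>i<n. (cmod (w (k, i)))\<^sup>2)"
        by (subst Bochner_Integration.integral_sum) (simp_all only: parseval_polynomial)
      also have "\<dots> = (L2_set (\<lambda>j. cmod (w j)) I)\<^sup>2"
        by (simp add: L2_set_sq I_def sum.cartesian_product)
      also have "\<dots> \<le> 1" using w by (simp add: power_le_one L2_set_nonneg)
      finally show "(LINT \<zeta>|circle_measure. (\<Sum>k<m. (cmod (\<Sum>i<n. w (k, i) * \<zeta> ^ i))\<^sup>2)) \<le> 1" .
      show "integrable circle_measure (\<lambda>\<zeta>. \<Sum>k<m. (cmod (\<Sum>i<n. w (k, i) * \<zeta> ^ i))\<^sup>2)"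
        by (intro Bochner_Integration.integrable_sum parseval_polynomial)
    qed
    have pt: "bform {..<m} (\<lambda>k l. g k l \<zeta>) (\<lambda>k. Y k \<zeta>) (\<lambda>l. X l \<zeta>) =
       (\<Sum>(k, i)\<in>I. \<Sum>(l, j)\<in>I. (y (k, i) * x (l, j)) * (\<zeta> ^ (i + j) * g k l \<zeta>))" for \<zeta>
    proof -
      have "Y k \<zeta> * (\<Sum>l<m. g k l \<zeta> * X l \<zeta>) =
          (\<Sum>i<n. \<Sum>l<m. \<Sum>j<n. (y (k, i) * x (l, j)) * (\<zeta> ^ (i + j) * g k l \<zeta>))" for k
      proof -
        have "Y k \<zeta> * (\<Sum>l<m. g k l \<zeta> * X l \<zeta>) = (\<Sum>i<n. y (k, i) * \<zeta> ^ i * (\<Sum>l<m. g k l \<zeta> * X l \<zeta>))"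
          unfolding Y_def by (rule sum_distrib_right)
        also have "\<dots> = (\<Sum>i<n. \<Sum>l<m. \<Sum>j<n. (y (k, i) * x (l, j)) * (\<zeta> ^ (i + j) * g k l \<zeta>))"
          unfolding X_def sum_distrib_left
          by (intro sum.cong refl) (simp add: power_add mult_ac)
        finally show ?thesis .
      qed
      then show ?thesis
        unfolding bform_def I_def sum.cartesian_product[symmetric] by simp
    qed
    have "bform I (\<lambda>(k, i) (l, j). LINT \<zeta>|circle_measure. \<zeta> ^ (i + j) * g k l \<zeta>) y x =
       (\<Sum>(k, i)\<in>I. \<Sum>(l, j)\<in>I. LINT \<zeta>|circle_measure. (y (k, i) * x (l, j)) * (\<zeta> ^ (i + j) * g k l \<zeta>))"
      unfolding bform_def sum_distrib_left split_def integral_mult_right_zero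
      by (intro sum.cong refl) (simp only: mult_ac prod.collapse)
    also have "\<dots> = (LINT \<zeta>|circle_measure. (\<Sum>(k, i)\<in>I. \<Sum>(l, j)\<in>I. (y (k, i) * x (l, j)) * (\<zeta> ^ (i + j) * g k l \<zeta>)))"
    proof -
      define h where "h a b \<zeta> = (y a * x b) * (\<zeta> ^ (snd a + snd b) * g (fst a) (fst b) \<zeta>)" for a b \<zeta>
      have inth: "integrable circle_measure (h a b)" if "a \<in> I" "b \<in> I" for a b
        unfolding h_def using that by (intro int) (auto simp: I_def)
      have "(\<Sum>a\<in>I. \<Sum>b\<in>I. LINT \<zeta>|circle_measure. h a b \<zeta>) = (LINT \<zeta>|circle_measure. (\<Sum>a\<in>I. \<Sum>b\<in>I. h a b \<zeta>))"
        by (simp add: Bochner_Integration.integral_sum Bochner_Integration.integrable_sum inth)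
      then show ?thesis by (simp add: h_def split_def)
    qed
    also have "\<dots> = (LINT \<zeta>|circle_measure. bform {..<m} (\<lambda>k l. g k l \<zeta>) (\<lambda>k. Y k \<zeta>) (\<lambda>l. X l \<zeta>))"
      unfolding pt ..
    finally have eq: "bform I (\<lambda>(k, i) (l, j). LINT \<zeta>|circle_measure. \<zeta> ^ (i + j) * g k l \<zeta>) y x =
      (LINT \<zeta>|circle_measure. bform {..<m} (\<lambda>k l. g k l \<zeta>) (\<lambda>k. Y k \<zeta>) (\<lambda>l. X l \<zeta>))" .
    have intb: "integrable circle_measure (\<lambda>\<zeta>. bform {..<m} (\<lambda>k l. g k l \<zeta>) (\<lambda>k. Y k \<zeta>) (\<lambda>l. X l \<zeta>))"
      unfolding pt split_def
      by (intro Bochner_Integration.integrable_sum int) (auto simp: I_def)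
    \<comment> \<open>the arithmetic mean of the two squared norms stands in for the Cauchy-Schwarz inequality for integrals\<close>
    define S where "S \<zeta> = (\<Sum>k<m. (cmod (Y k \<zeta>))\<^sup>2) / 2 + (\<Sum>k<m. (cmod (X k \<zeta>))\<^sup>2) / 2" for \<zeta>
    have intS: "integrable circle_measure S"
      unfolding S_def X_def Y_def using sq(2)[OF x] sq(2)[OF y] by auto
    have "cmod (LINT \<zeta>|circle_measure. bform {..<m} (\<lambda>k l. g k l \<zeta>) (\<lambda>k. Y k \<zeta>) (\<lambda>l. X l \<zeta>))
       \<le> (LINT \<zeta>|circle_measure. cmod (bform {..<m} (\<lambda>k l. g k l \<zeta>) (\<lambda>k. Y k \<zeta>) (\<lambda>l. X l \<zeta>)))"
      by (rule integral_norm_bound)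
    also have "\<dots> \<le> (LINT \<zeta>|circle_measure. S \<zeta>)"
    proof (rule integral_mono_AE[OF integrable_norm[OF intb] intS])
      show "AE \<zeta> in circle_measure. cmod (bform {..<m} (\<lambda>k l. g k l \<zeta>) (\<lambda>k. Y k \<zeta>) (\<lambda>l. X l \<zeta>)) \<le> S \<zeta>"
        using ae
      proof eventually_elim
        case (elim \<zeta>)
        define a where "a = L2_set (\<lambda>k. cmod (Y k \<zeta>)) {..<m}"
        define b where "b = L2_set (\<lambda>k. cmod (X k \<zeta>)) {..<m}"
        have ab: "0 \<le> a" "0 \<le> b" by (simp_all add: a_def b_def L2_set_nonneg)
        have "cmod (bform {..<m} (\<lambda>k l. g k l \<zeta>) (\<lambda>k. Y k \<zeta>) (\<lambda>l. X l \<zeta>)) \<le>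
           matrix_op_norm {..<m} (\<lambda>k l. g k l \<zeta>) * a * b"
          unfolding a_def b_def by (rule bform_le) simp
        also have "\<dots> \<le> 1 * a * b"
          using elim ab by (intro mult_right_mono) auto
        also have "\<dots> \<le> a\<^sup>2 / 2 + b\<^sup>2 / 2"
          using sum_squares_bound[of a b] by simp
        also have "\<dots> = S \<zeta>" by (simp add: S_def a_def b_def L2_set_sq)
        finally show ?case .
      qed
    qed
    also have "\<dots> = (LINT \<zeta>|circle_measure. (\<Sum>k<m. (cmod (Y k \<zeta>))\<^sup>2)) / 2 + (LINT \<zeta>|circle_measure. (\<Sum>k<m. (cmod (X k \<zeta>))\<^sup>2)) / 2"
      unfolding S_def using sq(2)[OF x] sq(2)[OF y] by (simp add: X_def Y_def)
    also have "\<dots> \<le> 1 / 2 + 1 / 2"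
      unfolding X_def Y_def using sq(1)[OF x] sq(1)[OF y] by (intro add_mono divide_right_mono) auto
    finally show "cmod (bform I (\<lambda>(k, i) (l, j). LINT \<zeta>|circle_measure. \<zeta> ^ (i + j) * g k l \<zeta>) y x) \<le> 1"
      unfolding eq by simp
  qed
  then show "Mn_matrix_norm n m (\<lambda>k l i j. LINT \<zeta>|circle_measure. \<zeta> ^ (i + j) * g k l \<zeta>) \<le> 1"
    by (simp add: Mn_matrix_norm_def I_def)
qed

text \<open>
  The test vector is supported on the diagonal indices \<open>(j, j)\<close>, where the Gram matrix has the entries
  \<open>1 / (i + j + 1)\<close> of the Hilbert matrix.
\<close>

lemma hankel_gram_norm_ge:
  assumes "c * harm n \<le> (\<Sum>i<n. \<Sum>j<n. 1 / (sqrt (real (i + 1)) * sqrt (real (j + 1)) * real (i + j + 1)))" "n > 0"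
  shows "c \<le> matrix_op_norm ({..<n} \<times> {..<n}) (\<lambda>(i, p) (j, q).
     LINT z|disk_measure. z ^ (i + j) * cnj (z ^ (p + q)))"
proof -
  define A where "A = (\<lambda>(i, p) (j, q). LINT z|disk_measure. z ^ (i + j) * cnj (z ^ (p + q)))"
  have A: "A (i, p) (j, q) = (if i + j = p + q then of_real (1 / real (i + j + 1)) else 0)" for i p j q
  proof -
    have "A (i, p) (j, q) = (LINT z|disk_measure. indicator (ball 0 1) z *\<^sub>R (z ^ (i + j) * cnj (z ^ (p + q))))"
      unfolding A_def prod.case by (intro Bochner_Integration.integral_cong refl) (simp add: indicator_def)
    also have "\<dots> = (if i + j = p + q then of_real ((1\<^sup>2) ^ (i + j + 1) / (i + j + 1)) else 0)"
      by (rule integral_monomials_ball) auto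
    finally show ?thesis by simp
  qed
  define x where "x = (\<lambda>(j, q). if j = q then complex_of_real (1 / sqrt (real (j + 1))) else 0)"
  define I where "I = {..<n} \<times> {..<n}"
  have norm: "(L2_set (\<lambda>j. cmod (x j)) I)\<^sup>2 = harm n"
  proof -
    have "(L2_set (\<lambda>j. cmod (x j)) I)\<^sup>2 = (\<Sum>j<n. \<Sum>q<n. (cmod (x (j, q)))\<^sup>2)"
      by (simp add: L2_set_sq I_def sum.cartesian_product)
    also have "\<dots> = (\<Sum>j<n. \<Sum>q<n. if j = q then 1 / real (j + 1) else 0)"
      by (intro sum.cong refl) (auto simp: x_def norm_divide power_divide)
    also have "\<dots> = harm n" by (simp add: harm_altdef inverse_eq_divide)
    finally show ?thesis .
  qed
  have row: "(\<Sum>(j, q)\<in>I. A (i, p) (j, q) * x (j, q)) = (\<Sum>j<n. A (i, p) (j, j) * x (j, j))" for i p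
  proof -
    have "(\<Sum>(j, q)\<in>I. A (i, p) (j, q) * x (j, q)) = (\<Sum>j<n. \<Sum>q<n. A (i, p) (j, q) * x (j, q))"
      by (simp add: I_def sum.cartesian_product)
    also have "\<dots> = (\<Sum>j<n. \<Sum>q<n. if j = q then A (i, p) (j, j) * x (j, j) else 0)"
      by (intro sum.cong refl) (simp add: x_def)
    finally show ?thesis by simp
  qed
  have "bform I A x x = (\<Sum>(i, p)\<in>I. x (i, p) * (\<Sum>(j, q)\<in>I. A (i, p) (j, q) * x (j, q)))"
    by (simp add: bform_def split_def)
  also have "\<dots> = (\<Sum>i<n. \<Sum>p<n. x (i, p) * (\<Sum>j<n. A (i, p) (j, j) * x (j, j)))"
    unfolding row by (simp add: I_def sum.cartesian_product)
  also have "\<dots> = (\<Sum>i<n. \<Sum>p<n. if i = p then x (i, i) * (\<Sum>j<n. A (i, i) (j, j) * x (j, j)) else 0)"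
  proof (intro sum.cong refl)
    fix i p
    show "x (i, p) * (\<Sum>j<n. A (i, p) (j, j) * x (j, j)) =
        (if i = p then x (i, i) * (\<Sum>j<n. A (i, i) (j, j) * x (j, j)) else 0)"
      by (cases "i = p") (simp_all add: x_def)
  qed
  also have "\<dots> = (\<Sum>i<n. x (i, i) * (\<Sum>j<n. A (i, i) (j, j) * x (j, j)))" by simp
  also have "\<dots> = of_real (\<Sum>i<n. \<Sum>j<n. 1 / (sqrt (real (i + 1)) * sqrt (real (j + 1)) * real (i + j + 1)))"
    unfolding of_real_sum sum_distrib_left
    by (intro sum.cong refl) (simp add: A x_def mult_ac)
  finally have "c * harm n \<le> cmod (bform I A x x)"
    using assms(1) by (simp only: norm_of_real)
  also have "\<dots> \<le> matrix_op_norm I A * L2_set (\<lambda>j. cmod (x j)) I * L2_set (\<lambda>j. cmod (x j)) I"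
    by (rule bform_le) (simp add: I_def)
  also have "\<dots> = matrix_op_norm I A * harm n"
    by (simp add: norm[symmetric] power2_eq_square)
  finally show ?thesis
    using harm_pos[OF assms(2), where 'a = real] by (simp add: A_def I_def)
qed

lemma cb_norm_carleman_ge:
  "ennreal (sqrt pi) \<le> cb_norm Hardy1 L1_matrix_norm (OH_matrix_norm disk_measure) carleman"
proof -
  let ?cb = "cb_norm Hardy1 L1_matrix_norm (OH_matrix_norm disk_measure) carleman"
  have ge: "ennreal (sqrt c) \<le> ?cb" if "c < pi" for c
  proof -
    from hilbert_form_near_pi[OF that] obtain n where n: "n > 0"
      "c * harm n \<le> (\<Sum>i<n. \<Sum>j<n. 1 / (sqrt (real (i + 1)) * sqrt (real (j + 1)) * real (i + j + 1)))" by blast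
    let ?f = "\<lambda>i j \<zeta>. \<zeta> ^ (i + j) :: complex"
    have "OH_matrix_norm disk_measure n (\<lambda>i j. carleman (?f i j)) =
       ennreal (sqrt (matrix_op_norm ({..<n} \<times> {..<n}) (\<lambda>(i, p) (j, q).
         LINT z|disk_measure. carleman (?f i j) z * cnj (carleman (?f p q) z))))"
      by (intro OH_matrix_norm_eq_gram carleman_square_integrable power_mem_Hardy1)
    then have "ennreal (sqrt c) \<le> OH_matrix_norm disk_measure n (\<lambda>i j. carleman (?f i j))"
      unfolding carleman_power using hankel_gram_norm_ge[OF n(2,1)] by (simp add: ennreal_leI)
    also have "\<dots> \<le> ?cb"
      unfolding cb_norm_def
      by (rule SUP_upper2[of "(n, ?f)"]) (auto intro: power_mem_Hardy1 L1_matrix_norm_hankel)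
    finally show ?thesis .
  qed
  show ?thesis
  proof (rule ccontr)
    assume "\<not> ?thesis"
    then have less: "?cb < ennreal (sqrt pi)" by simp
    then obtain y where y: "?cb = ennreal y" "0 \<le> y" by (cases ?cb) auto
    with less have "y < sqrt pi" by (simp add: ennreal_less_iff)
    then have "y\<^sup>2 < pi" using y(2) by (metis real_less_rsqrt real_sqrt_less_iff real_sqrt_unique)
    then obtain c where c: "y\<^sup>2 < c" "c < pi" using dense by blast
    then have "y < sqrt c" by (simp add: real_less_rsqrt)
    moreover have "ennreal (sqrt c) \<le> ennreal y" using ge[OF c(2)] y(1) by simp
    then have "sqrt c \<le> y" using y(2) by (simp add: ennreal_le_iff)
    ultimately show False by simp
  qed
qed

theorem corollary6p13:
  shows "carleman \<in> Hardy1 \<rightarrow> Bergman2 \<and>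
    cb_norm Hardy1 L1_matrix_norm (OH_matrix_norm disk_measure) carleman = ennreal (sqrt pi)"
proof
  show "carleman \<in> Hardy1 \<rightarrow> Bergman2"
    by (auto simp: Bergman2_def carleman_holomorphic carleman_square_integrable)
  show "cb_norm Hardy1 L1_matrix_norm (OH_matrix_norm disk_measure) carleman = ennreal (sqrt pi)"
    by (rule antisym[OF cb_norm_carleman_le cb_norm_carleman_ge])
qed

end
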